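(* Let $(X,T)$ be a dynamical system which is transitive and has the shadowing property. Then the collection of ergodic $T$-invariant Borel probability measures on $X$ which are supported on odometers is dense in the space $M_T(X)$ of all $T$-invariant Borel probability measures on $X$ (with the weak$^*$-topology). In particular, ergodic measures are generic in $M_T(X)$, i.e. the set of ergodic measures is residual in $M_T(X)$.
   Context: A dynamical system $(X,T)$ is a compact metric space $(X,d)$ with a continuous map $T\colon X\to X$ (not necessarily invertible). It is transitive if for any two nonempty open sets $U,V\subset X$ there is $n>0$ with $T^n(U)\cap V\neq\emptyset$. A sequence $(x_n)_{n=0}^\infty$ in $X$ is a $\delta$-pseudo-orbit if $d(T(x_n),x_{n+1})<\delta$ for all $n\ge 0$; it is $\varepsilon$-traced by $y\in X$ if $d(T^n(y),x_n)<\varepsilon$ for all $n\ge 0$. $(X,T)$ has the shadowing property if for every $\varepsilon>0$ there is $\delta>0$ such that every $\delta$-pseudo-orbit is $\varepsilon$-traced by some point of $X$. A point $x$ is regularly recurrent if for every open neighborhood $U$ of $x$ there is $k\ge 1$ with $T^{kn}(x)\in U$ for all $n\ge 0$. $(X,T)$ is equicontinuous if for every $\varepsilon>0$ there is $\delta>0$ such that $d(x,y)<\delta$ implies $d(T^n(x),T^n(y))<\varepsilon$ for all $n\ge 0$. An odometer is an equicontinuous system containing a regularly recurrent point with dense (forward) orbit; in particular a periodic orbit is an odometer. A measure $\mu$ is supported on an odometer if there is a closed set $Z\subset X$ with $T(Z)\subset Z$ and $\mu(Z)=1$ such that $(Z,T|_Z)$ is an odometer. A set is residual if its complement is of first category.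 *)

theory Defs
  imports "HOL-Probability.Probability"
begin

text \<open>
  A system \<open>(X, T)\<close> is a compact subset \<open>X\<close> of a metric type together with a map \<open>T\<close>, of which
  only the restriction to \<open>X\<close> matters. Taking \<open>X\<close> as an explicit carrier lets the same notions
  apply to a system and to its subsystems \<open>(Z, T|Z)\<close>.
\<close>

definition dynamical_system :: "'a::metric_space set \<Rightarrow> ('a \<Rightarrow> 'a) \<Rightarrow> bool" where
  "dynamical_system X T \<longleftrightarrow> compact X \<and> continuous_on X T \<and> T ` X \<subseteq> X"

definition transitive_system :: "'a::metric_space set \<Rightarrow> ('a \<Rightarrow> 'a) \<Rightarrow> bool" where
  "transitive_system X T \<longleftrightarrow>
    (\<forall>U V. openin (top_of_set X) U \<and> openin (top_of_set X) V \<and> U \<noteq> {} \<and> V \<noteq> {} \<longrightarrow>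
      (\<exists>n>0. (T ^^ n) ` U \<inter> V \<noteq> {}))"

definition pseudo_orbit :: "'a::metric_space set \<Rightarrow> ('a \<Rightarrow> 'a) \<Rightarrow> real \<Rightarrow> (nat \<Rightarrow> 'a) \<Rightarrow> bool" where
  "pseudo_orbit X T \<delta> x \<longleftrightarrow> (\<forall>n. x n \<in> X) \<and> (\<forall>n. dist (T (x n)) (x (Suc n)) < \<delta>)"

definition traces :: "('a::metric_space \<Rightarrow> 'a) \<Rightarrow> real \<Rightarrow> 'a \<Rightarrow> (nat \<Rightarrow> 'a) \<Rightarrow> bool" where
  "traces T \<epsilon> y x \<longleftrightarrow> (\<forall>n. dist ((T ^^ n) y) (x n) < \<epsilon>)"

definition shadowing :: "'a::metric_space set \<Rightarrow> ('a \<Rightarrow> 'a) \<Rightarrow> bool" where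
  "shadowing X T \<longleftrightarrow>
    (\<forall>\<epsilon>>0. \<exists>\<delta>>0. \<forall>x. pseudo_orbit X T \<delta> x \<longrightarrow> (\<exists>y\<in>X. traces T \<epsilon> y x))"

definition regularly_recurrent :: "'a::metric_space set \<Rightarrow> ('a \<Rightarrow> 'a) \<Rightarrow> 'a \<Rightarrow> bool" where
  "regularly_recurrent X T x \<longleftrightarrow>
    x \<in> X \<and> (\<forall>U. openin (top_of_set X) U \<and> x \<in> U \<longrightarrow> (\<exists>k\<ge>1. \<forall>n. (T ^^ (k * n)) x \<in> U))"

definition equicontinuous_system :: "'a::metric_space set \<Rightarrow> ('a \<Rightarrow> 'a) \<Rightarrow> bool" where
  "equicontinuous_system X T \<longleftrightarrow>
    (\<forall>\<epsilon>>0. \<exists>\<delta>>0. \<forall>x\<in>X. \<forall>y\<in>X. dist x y < \<delta> \<longrightarrow> (\<forall>n. dist ((T ^^ n) x) ((T ^^ n) y) < \<epsilon>))"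

definition odometer :: "'a::metric_space set \<Rightarrow> ('a \<Rightarrow> 'a) \<Rightarrow> bool" where
  "odometer X T \<longleftrightarrow> dynamical_system X T \<and> equicontinuous_system X T \<and>
    (\<exists>x. regularly_recurrent X T x \<and> X \<subseteq> closure (range (\<lambda>n. (T ^^ n) x)))"

text \<open>Borel probability measures on \<open>X\<close> have underlying space \<open>X\<close>, not the whole type.\<close>

definition borel_prob_measures :: "'a::metric_space set \<Rightarrow> 'a measure set" where
  "borel_prob_measures X = {\<mu>. prob_space \<mu> \<and> sets \<mu> = sets (restrict_space borel X)}"

definition invariant_measures :: "'a::metric_space set \<Rightarrow> ('a \<Rightarrow> 'a) \<Rightarrow> 'a measure set" where
  "invariant_measures X T =
    {\<mu> \<in> borel_prob_measures X. \<forall>A\<in>sets \<mu>. measure \<mu> (T -` A \<inter> X) = measure \<mu> A}"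

definition ergodic_measures :: "'a::metric_space set \<Rightarrow> ('a \<Rightarrow> 'a) \<Rightarrow> 'a measure set" where
  "ergodic_measures X T =
    {\<mu> \<in> invariant_measures X T.
      \<forall>A\<in>sets \<mu>. T -` A \<inter> X = A \<longrightarrow> measure \<mu> A = 0 \<or> measure \<mu> A = 1}"

definition supported_on_odometer ::
    "'a::metric_space set \<Rightarrow> ('a \<Rightarrow> 'a) \<Rightarrow> 'a measure \<Rightarrow> bool" where
  "supported_on_odometer X T \<mu> \<longleftrightarrow>
    (\<exists>Z. closedin (top_of_set X) Z \<and> T ` Z \<subseteq> Z \<and> measure \<mu> Z = 1 \<and> odometer Z T)"

text \<open>
  The weak* topology is the initial topology for the functionals \<open>\<mu> \<mapsto> \<integral> f d\<mu>\<close>, with \<open>f\<close> continuous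
  on \<open>X\<close>: it is pulled back from the topology of pointwise convergence on \<open>C(X)\<close>.
\<close>

definition weak_star_topology :: "'a::metric_space set \<Rightarrow> 'a measure topology" where
  "weak_star_topology X =
    pullback_topology (borel_prob_measures X)
      (\<lambda>\<mu>. \<lambda>f\<in>{f. continuous_on X f}. \<integral>x. f x \<partial>\<mu>)
      (powertop_real {f. continuous_on X f})"

definition invariant_measures_topology ::
    "'a::metric_space set \<Rightarrow> ('a \<Rightarrow> 'a) \<Rightarrow> 'a measure topology" where
  "invariant_measures_topology X T =
    subtopology (weak_star_topology X) (invariant_measures X T)"

lemma topspace_invariant_measures_topology [simp]:
  "topspace (invariant_measures_topology X T) = invariant_measures X T"
  by (auto simp: invariant_measures_topology_def weak_star_topology_def topspace_pullback_topology
      invariant_measures_def)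

definition dense_in :: "'a topology \<Rightarrow> 'a set \<Rightarrow> bool" where
  "dense_in Y S \<longleftrightarrow> S \<subseteq> topspace Y \<and> Y closure_of S = topspace Y"

definition nowhere_dense_in :: "'a topology \<Rightarrow> 'a set \<Rightarrow> bool" where
  "nowhere_dense_in Y S \<longleftrightarrow> S \<subseteq> topspace Y \<and> Y interior_of (Y closure_of S) = {}"

definition first_category_in :: "'a topology \<Rightarrow> 'a set \<Rightarrow> bool" where
  "first_category_in Y S \<longleftrightarrow>
    (\<exists>\<N>. countable \<N> \<and> (\<forall>N\<in>\<N>. nowhere_dense_in Y N) \<and> S = \<Union>\<N>)"

definition residual_in :: "'a topology \<Rightarrow> 'a set \<Rightarrow> bool" where
  "residual_in Y S \<longleftrightarrow> S \<subseteq> topspace Y \<and> first_category_in Y (topspace Y - S)"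

end

theory Submission
  imports Defs "HOL-Real_Asymp.Real_Asymp"
begin

text \<open>
  Density. Since \<open>\<mu>\<close> is invariant, \<open>\<integral> f d\<mu>\<close> is approximated by a finite average of Birkhoff averages
  of large length \<open>N\<close>; transitivity and compactness join the corresponding orbit segments, by chains
  of length bounded independently of \<open>N\<close>, to one periodic \<open>\<delta>\<close>-pseudo-orbit. A point tracing it
  returns, at some multiple of the period, so closely that its orbit closes up to a periodic
  \<open>\<delta>'\<close>-pseudo-orbit for a much smaller \<open>\<delta>'\<close>. Iterating, the pseudo-orbits converge uniformly to an
  orbit that is, at every scale, almost periodic with an exact period; its closure is an odometer,
  on which Birkhoff averages converge uniformly.

  Genericity. The measures for which the Birkhoff averages of \<open>f\<close> have variance \<open>< e\<close> at some time
  form an open set containing these odometer measures. Intersecting over a countable family of \<open>f\<close>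
  and over \<open>e = 1, 1/2, 1/3, \<dots>\<close> leaves only ergodic measures.
\<close>

section \<open>Orbits limiting periodic pseudo-orbits\<close>

text \<open>A point tracing a periodic pseudo-orbit need not be periodic, and without expansivity
  nothing forces it to be; therefore the limit is in general an odometer and not a periodic orbit.
  Exact periods live only on the approximating pseudo-orbits. Each period divides the next, which
  makes the residues modulo the periods compatible.

  Invariance takes the place of the ergodic theorem: \<open>f\<close> and its Birkhoff average of
  length \<open>N\<close> have the same integral, so that finitely many starting points represent
  \<mu>. The joining chains are negligible because their length is bounded before \<open>N\<close>
  is chosen.

  Ergodicity as defined is not visibly a weak* condition. For one fixed \<open>N\<close>, however,
  the variance of a Birkhoff average is built from integrals of two continuous functions, which is
  why its smallness is open. Residuality asks only that countably many nowhere dense sets cover the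
  complement, so no Baire theorem for the space of measures enters.\<close>

lemma funpow_in_invariant_set:
  assumes "T ` X \<subseteq> X" "x \<in> X"
  shows "(T ^^ n) x \<in> X"
  using assms by (induction n) auto

lemma continuous_on_funpow:
  fixes T :: "'a::topological_space \<Rightarrow> 'a"
  assumes "continuous_on X T" "T ` X \<subseteq> X"
  shows "continuous_on X (T ^^ n)"
proof (induction n)
  case (Suc n)
  have "(T ^^ n) ` X \<subseteq> X"
    using funpow_in_invariant_set[OF assms(2)] by blast
  then have "continuous_on X (T \<circ> (T ^^ n))"
    using Suc assms(1) by (meson continuous_on_compose continuous_on_subset)
  then show ?case by simp
qed simp

text \<open>In the library only for \<open>heine_borel\<close> spaces.\<close>

lemma compact_closed_separated:
  fixes S C :: "'a::metric_space set"
  assumes "compact S" "closed C" "S \<inter> C = {}"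
  shows "\<exists>\<delta>>0. \<forall>x\<in>S. \<forall>y\<in>C. \<delta> \<le> dist x y"
proof (cases "S = {} \<or> C = {}")
  case False
  have "continuous_on S (\<lambda>x. infdist x C)" by (intro continuous_intros)
  then have "\<exists>x0\<in>S. \<forall>x\<in>S. infdist x0 C \<le> infdist x C"
    using False by (intro continuous_attains_inf assms(1)) simp
  then obtain x0 where x0: "x0 \<in> S" "\<And>x. x \<in> S \<Longrightarrow> infdist x0 C \<le> infdist x C" by blast
  have "infdist x0 C > 0"
  proof -
    have "x0 \<notin> C" using x0(1) assms(3) by blast
    then have "infdist x0 C \<noteq> 0" using in_closed_iff_infdist_zero[OF assms(2)] False by simp
    then show ?thesis using infdist_nonneg[of x0 C] by simp
  qed
  moreover have "infdist x0 C \<le> dist x y" if "x \<in> S" "y \<in> C" for x y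
    using x0(2)[OF that(1)] infdist_le[OF that(2), of x] by linarith
  ultimately show ?thesis by blast
qed (auto intro: exI[of _ 1])

lemma pigeonhole_close_terms:
  fixes f :: "nat \<Rightarrow> 'a::metric_space"
  assumes "compact X" "\<And>i. f i \<in> X" "\<delta> > 0"
  obtains i j where "i < j" "dist (f j) (f i) < \<delta>"
proof -
  obtain l r where r: "strict_mono r" "(f \<circ> r) \<longlonglongrightarrow> l"
    using assms(1,2) unfolding compact_def by blast
  then have "Cauchy (f \<circ> r)" by (metis LIMSEQ_imp_Cauchy)
  then obtain M where "\<And>m n. m \<ge> M \<Longrightarrow> n \<ge> M \<Longrightarrow> dist ((f \<circ> r) m) ((f \<circ> r) n) < \<delta>"
    using assms(3) unfolding Cauchy_def by meson
  then have "dist (f (r (Suc M))) (f (r M)) < \<delta>" by simp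
  moreover have "r M < r (Suc M)" using r(1) by (simp add: strict_mono_Suc_iff)
  ultimately show ?thesis using that by blast
qed

lemma periodic_mod:
  fixes x :: "nat \<Rightarrow> 'b"
  assumes "\<And>i. x (i + p) = x i"
  shows "x (i mod p) = x i"
proof -
  have "x (r + p * q) = x r" for q r
    by (induction q) (simp, metis assms add.assoc add.commute mult_Suc_right)
  from this[of "i mod p" "i div p"] show ?thesis by simp
qed

text \<open>Along a tracing orbit sampled at multiples of the period two points come close by
  compactness; starting at the first of them, the tracing orbit closes up to a finer periodic
  pseudo-orbit.\<close>

lemma refine_periodic_pseudo_orbit:
  fixes T :: "'a::metric_space \<Rightarrow> 'a"
  assumes X: "compact X" "T ` X \<subseteq> X"
    and shadow: "\<And>x. pseudo_orbit X T \<delta> x \<Longrightarrow> \<exists>y\<in>X. traces T \<epsilon> y x"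
    and x: "pseudo_orbit X T \<delta> x" "p > 0" "\<And>i. x (i + p) = x i"
    and "\<delta>' > 0"
  shows "\<exists>x' p'. p' > 0 \<and> p dvd p' \<and> pseudo_orbit X T \<delta>' x' \<and> (\<forall>i. x' (i + p') = x' i) \<and>
           (\<forall>i. dist (x' i) (x i) < \<epsilon>)"
proof -
  obtain y where y: "y \<in> X" "\<And>i. dist ((T ^^ i) y) (x i) < \<epsilon>"
    using shadow[OF x(1)] unfolding traces_def by blast
  obtain a b where ab: "a < b" "dist ((T ^^ (b * p)) y) ((T ^^ (a * p)) y) < \<delta>'"
    by (rule pigeonhole_close_terms[of X "\<lambda>i. (T ^^ (i * p)) y" \<delta>'])
       (use X y(1) funpow_in_invariant_set \<open>\<delta>' > 0\<close> in auto)
  define w where "w = (T ^^ (a * p)) y"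
  define p' where "p' = (b - a) * p"
  define x' where "x' i = (T ^^ (i mod p')) w" for i
  have p': "p' > 0" "p dvd p'" using ab(1) x(2) by (auto simp: p'_def)
  have wX: "(T ^^ i) w \<in> X" for i
    using X(2) y(1) by (simp add: w_def funpow_in_invariant_set)
  have "(T ^^ p') w = (T ^^ (b * p)) y"
    using ab(1) by (simp add: w_def p'_def diff_mult_distrib flip: funpow_add comp_apply[of "T ^^ _"])
  then have closing: "dist ((T ^^ p') w) w < \<delta>'" using ab(2) by (simp add: w_def)
  have "dist (T (x' i)) (x' (Suc i)) < \<delta>'" for i
  \<comment> \<open>The only jump is the wrap-around from \<open>(T ^^ (p' - 1)) w\<close> to
    \<open>w\<close>; elsewhere \<open>x'\<close> follows the orbit of \<open>w\<close>
    exactly.\<close>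
  proof (cases "Suc (i mod p') = p'")
    case True
    then have "Suc i mod p' = 0" by (simp add: mod_Suc)
    then have "x' (Suc i) = w" "T (x' i) = (T ^^ p') w"
      using True by (auto simp: x'_def simp flip: funpow.simps(2) comp_apply[of T])
    then show ?thesis using closing by simp
  next
    case False
    then have "Suc i mod p' = Suc (i mod p')" by (simp add: mod_Suc)
    then show ?thesis using \<open>\<delta>' > 0\<close> by (simp add: x'_def)
  qed
  then have "pseudo_orbit X T \<delta>' x'" using wX by (simp add: pseudo_orbit_def x'_def)
  moreover have "dist (x' i) (x i) < \<epsilon>" for i
  proof -
    \<comment> \<open>The two indices are congruent modulo \<open>p\<close>, because
      \<open>p\<close> divides \<open>p'\<close>.\<close>
    have "x (i mod p' + a * p) = x i"
      by (metis mod_mult_self1 mod_mod_cancel p'(2) periodic_mod[of x, OF x(3)])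
    moreover have "x' i = (T ^^ (i mod p' + a * p)) y"
      by (simp add: x'_def w_def funpow_add)
    ultimately show ?thesis using y(2) by metis
  qed
  ultimately show ?thesis using p' by (intro exI[of _ x'] exI[of _ p']) (simp add: x'_def)
qed

text \<open>Refining again and again moves the pseudo-orbit by summable amounts while the jumps tend
  to 0, so the limit is an orbit. The first period survives as \<open>n 0 = p\<close>, which later
  allows the limit orbit to be compared with \<open>x\<close> over one period of
  \<open>x\<close>.\<close>

lemma shadowing_limit_orbit:
  fixes T :: "'a::metric_space \<Rightarrow> 'a"
  assumes sys: "dynamical_system X T" and shadow: "shadowing X T" and "e > 0"
  shows "\<exists>\<delta>>0. \<forall>x p. p > 0 \<longrightarrow> pseudo_orbit X T \<delta> x \<longrightarrow> (\<forall>i. x (i + p) = x i) \<longrightarrow>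
    (\<exists>z\<in>X. \<exists>n. n 0 = p \<and> (\<forall>k. n k > 0 \<and> n k dvd n (Suc k)) \<and>
       (\<forall>k i j. i mod n k = j mod n k \<longrightarrow> dist ((T ^^ i) z) ((T ^^ j) z) \<le> e / 2 ^ k) \<and>
       (\<forall>i. dist ((T ^^ i) z) (x i) \<le> e))"
proof -
  have X: "compact X" "continuous_on X T" "T ` X \<subseteq> X" using sys by (auto simp: dynamical_system_def)
  \<comment> \<open>The corrections from stage \<open>k\<close> on add up to
    \<open>2 * \<epsilon> k\<close>. Two limit points near the same point of stage \<open>k\<close>
    are therefore within \<open>4 * \<epsilon> k = e / 2 ^ k\<close> of each other.\<close>
  define \<epsilon> where "\<epsilon> k = e / 2 ^ (k + 2)" for k :: nat
  have \<epsilon>_pos: "\<epsilon> k > 0" for k using \<open>e > 0\<close> by (simp add: \<epsilon>_def)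
  have "\<forall>k. \<exists>\<delta>>0. \<forall>x. pseudo_orbit X T \<delta> x \<longrightarrow> (\<exists>y\<in>X. traces T (\<epsilon> k) y x)"
    using shadow \<epsilon>_pos unfolding shadowing_def by blast
  then obtain \<delta>0 where \<delta>0: "\<And>k. \<delta>0 k > 0"
      "\<And>k x. pseudo_orbit X T (\<delta>0 k) x \<Longrightarrow> \<exists>y\<in>X. traces T (\<epsilon> k) y x"
    by metis
  \<comment> \<open>The first bound provides tracing; the second makes the jumps tend to 0, so that
    the limit is a genuine orbit.\<close>
  define \<delta> where "\<delta> k = min (\<delta>0 k) (\<epsilon> k)" for k
  have \<delta>_pos: "\<delta> k > 0" for k using \<delta>0(1) \<epsilon>_pos by (simp add: \<delta>_def)
  have trace: "\<exists>y\<in>X. traces T (\<epsilon> k) y x" if "pseudo_orbit X T (\<delta> k) x" for k x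
    using that \<delta>0(2)[of k x] by (auto simp: pseudo_orbit_def \<delta>_def)
  have "\<exists>z\<in>X. \<exists>n. n 0 = p \<and> (\<forall>k. n k > 0 \<and> n k dvd n (Suc k)) \<and>
       (\<forall>k i j. i mod n k = j mod n k \<longrightarrow> dist ((T ^^ i) z) ((T ^^ j) z) \<le> e / 2 ^ k) \<and>
       (\<forall>i. dist ((T ^^ i) z) (x0 i) \<le> e)"
    if x0: "p > 0" "pseudo_orbit X T (\<delta> 0) x0" "\<forall>i. x0 (i + p) = x0 i" for x0 p
  proof -
    \<comment> \<open>Stage \<open>k\<close> is a pair of a pseudo-orbit and its period. Dependent
      choice leaves the first term open, so the last conjunct pins it to
      \<open>(x0, p)\<close>.\<close>
    define P where "P k q \<longleftrightarrow> (0::nat) < snd q \<and> pseudo_orbit X T (\<delta> k) (fst q) \<and>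
        (\<forall>i. fst q (i + snd q) = fst q i) \<and> (k = 0 \<longrightarrow> q = (x0, p))" for k and q :: "(nat \<Rightarrow> 'a) \<times> nat"
    define Q where "Q k q q' \<longleftrightarrow> snd q dvd snd q' \<and> (\<forall>i. dist (fst q' i) (fst q i) < \<epsilon> k)"
      for k :: nat and q q' :: "(nat \<Rightarrow> 'a) \<times> nat"
    have "\<exists>q. P 0 q" using x0 by (intro exI[of _ "(x0, p)"]) (simp add: P_def)
    moreover have "\<exists>q'. P (Suc k) q' \<and> Q k q q'" if "P k q" for k q
    proof -
      have "\<exists>x' p'. p' > 0 \<and> snd q dvd p' \<and> pseudo_orbit X T (\<delta> (Suc k)) x' \<and>
          (\<forall>i. x' (i + p') = x' i) \<and> (\<forall>i. dist (x' i) (fst q i) < \<epsilon> k)"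
        by (rule refine_periodic_pseudo_orbit[OF X(1,3), of "\<delta> k"])
           (use trace that \<delta>_pos in \<open>auto simp: P_def\<close>)
      then obtain x' p' where "p' > 0" "snd q dvd p'" "pseudo_orbit X T (\<delta> (Suc k)) x'"
          "\<forall>i. x' (i + p') = x' i" "\<forall>i. dist (x' i) (fst q i) < \<epsilon> k" by blast
      then show ?thesis by (intro exI[of _ "(x', p')"]) (simp add: P_def Q_def)
    qed
    ultimately obtain s where s: "\<And>k. P k (s k)" "\<And>k. Q k (s k) (s (Suc k))"
      using dependent_nat_choice[of P Q] by metis
    define x where "x k = fst (s k)" for k
    define n where "n k = snd (s k)" for k
    have n: "n 0 = p" "n k > 0" "n k dvd n (Suc k)" for k
      using s[of k] s(1)[of 0] by (auto simp: P_def Q_def n_def)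
    have x_0: "x 0 = x0" using s(1)[of 0] by (simp add: P_def x_def)
    have x: "x k i \<in> X" "dist (T (x k i)) (x k (Suc i)) < \<delta> k" "x k (i + n k) = x k i"
        "dist (x (Suc k) i) (x k i) < \<epsilon> k" for k i
      using s[of k] by (auto simp: P_def Q_def n_def x_def pseudo_orbit_def)
    \<comment> \<open>The right-hand side is the exact geometric sum of the corrections
      \<open>k\<close>, ..., \<open>k + m - 1\<close>; keeping the subtracted term lets the
      induction close.\<close>
    have "dist (x (k + m) i) (x k i) \<le> 2 * \<epsilon> k - 2 * \<epsilon> (k + m)" for k m i
    proof (induction m)
      case (Suc m)
      have "dist (x (k + Suc m) i) (x k i) \<le> dist (x (Suc (k + m)) i) (x (k + m) i) + dist (x (k + m) i) (x k i)"
        by (simp add: dist_triangle)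
      also have "\<dots> \<le> \<epsilon> (k + m) + (2 * \<epsilon> k - 2 * \<epsilon> (k + m))"
        using x(4)[of "k + m" i] Suc by linarith
      also have "\<dots> = 2 * \<epsilon> k - 2 * \<epsilon> (k + Suc m)" by (simp add: \<epsilon>_def field_simps)
      finally show ?case .
    qed simp
    note telescope = this
    have near: "dist (x m i) (x k i) \<le> 2 * \<epsilon> k" if "k \<le> m" for k m i
      using telescope[of k "m - k" i] \<epsilon>_pos[of m] that by simp
    have \<epsilon>_lim: "\<epsilon> \<longlonglongrightarrow> 0" unfolding \<epsilon>_def by real_asymp
    have "\<exists>y\<in>X. (\<lambda>k. x k i) \<longlonglongrightarrow> y" for i
    proof -
      have "Cauchy (\<lambda>k. x k i)"
      proof (rule metric_CauchyI)
        fix r :: real assume "r > 0"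
        then have "\<forall>\<^sub>F k in sequentially. \<epsilon> k < r / 4" using \<epsilon>_lim by (intro order_tendstoD(2)) auto
        then obtain K where "\<epsilon> K < r / 4" by (auto simp: eventually_sequentially)
        then have "dist (x k i) (x l i) < r" if "k \<ge> K" "l \<ge> K" for k l
          using near[OF that(1), of i] near[OF that(2), of i] dist_triangle2[of "x k i" "x l i" "x K i"]
          by linarith
        then show "\<exists>M. \<forall>m\<ge>M. \<forall>n\<ge>M. dist (x m i) (x n i) < r" by blast
      qed
      then show ?thesis using compact_imp_complete[OF X(1)] x(1) by (metis complete_def)
    qed
    then obtain y where y: "\<And>i. y i \<in> X" "\<And>i. (\<lambda>k. x k i) \<longlonglongrightarrow> y i" by metis
    have near_y: "dist (y i) (x k i) \<le> 2 * \<epsilon> k" for i k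
      by (rule LIMSEQ_le_const2[OF tendsto_dist[OF y(2) tendsto_const]]) (use near in blast)
    have "y (Suc i) = T (y i)" for i
    proof -
      have "(\<lambda>k. T (x k i)) \<longlonglongrightarrow> T (y i)"
        by (rule continuous_on_tendsto_compose[OF X(2) y(2)[of i]]) (use x(1) y(1) in auto)
      then have "(\<lambda>k. dist (T (x k i)) (x k (Suc i))) \<longlonglongrightarrow> dist (T (y i)) (y (Suc i))"
        by (intro tendsto_dist y(2))
      moreover have "dist (T (x k i)) (x k (Suc i)) \<le> \<epsilon> k" for k
        using x(2)[of k i] by (simp add: \<delta>_def)
      ultimately have "dist (T (y i)) (y (Suc i)) \<le> 0"
        by (intro LIMSEQ_le[OF _ \<epsilon>_lim]) auto
      then show ?thesis by simp
    qed
    then have orbit: "(T ^^ i) (y 0) = y i" for i by (induction i) auto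
    have "dist (y i) (y j) \<le> e / 2 ^ k" if "i mod n k = j mod n k" for i j k
    proof -
      have "x k i = x k j" using that periodic_mod[of "x k" "n k", OF x(3)] by metis
      then have "dist (y i) (y j) \<le> 2 * \<epsilon> k + 2 * \<epsilon> k"
        using near_y[of i k] near_y[of j k] dist_triangle2[of "y i" "y j" "x k i"] by simp
      then show ?thesis by (simp add: \<epsilon>_def)
    qed
    moreover have "dist (y i) (x0 i) \<le> e" for i
      using near_y[of i 0] \<open>e > 0\<close> by (simp add: x_0 \<epsilon>_def)
    ultimately show ?thesis using n y(1)[of 0] by (intro bexI[of _ "y 0"] exI[of _ n]) (auto simp: orbit)
  qed
  then show ?thesis using \<delta>_pos[of 0] by blast
qed

section \<open>Invariant measures and finite averages\<close>

lemma space_borel_prob_measures: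
  "\<mu> \<in> borel_prob_measures X \<Longrightarrow> space \<mu> = X"
  using sets_eq_imp_space_eq[of \<mu> "restrict_space borel X"]
  by (auto simp: borel_prob_measures_def space_restrict_space)

lemma borel_measurable_continuous_on_carrier:
  fixes f :: "'a::metric_space \<Rightarrow> 'b::topological_space"
  assumes "\<mu> \<in> borel_prob_measures X" "continuous_on X f"
  shows "f \<in> borel_measurable \<mu>"
proof -
  have "f \<in> borel_measurable (restrict_space borel X)"
    using assms(2) by (rule borel_measurable_continuous_on_restrict)
  moreover have "sets \<mu> = sets (restrict_space borel X)"
    using assms(1) by (simp add: borel_prob_measures_def)
  ultimately show ?thesis using measurable_cong_sets by blast
qed

lemma measurable_self_map:
  fixes T :: "'a::metric_space \<Rightarrow> 'a"
  assumes "\<mu> \<in> borel_prob_measures X" "continuous_on X T" "T ` X \<subseteq> X"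
  shows "T \<in> measurable \<mu> \<mu>"
proof -
  have "T \<in> measurable \<mu> (restrict_space borel X)"
    using borel_measurable_continuous_on_carrier[OF assms(1,2)] assms(3)
      space_borel_prob_measures[OF assms(1)]
    by (intro measurable_restrict_space2) auto
  moreover have "sets \<mu> = sets (restrict_space borel X)"
    using assms(1) by (simp add: borel_prob_measures_def)
  ultimately show ?thesis using measurable_cong_sets by blast
qed

lemma continuous_on_compact_bound:
  fixes f :: "'a::metric_space \<Rightarrow> real"
  assumes "compact X" "continuous_on X f"
  obtains B where "B \<ge> 0" "\<And>x. x \<in> X \<Longrightarrow> \<bar>f x\<bar> \<le> B"
proof -
  have "bounded (f ` X)" by (intro compact_imp_bounded compact_continuous_image assms)
  then obtain B where "\<forall>y\<in>f ` X. norm y \<le> B" "B > 0" by (auto simp: bounded_pos)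
  then show ?thesis using that[of B] by auto
qed

lemma finite_continuous_family_bound:
  fixes F :: "('a::metric_space \<Rightarrow> real) set"
  assumes X: "compact X" and F: "finite F" "\<And>f. f \<in> F \<Longrightarrow> continuous_on X f"
  shows "\<exists>B\<ge>0. \<forall>f\<in>F. \<forall>x\<in>X. \<bar>f x\<bar> \<le> B"
proof -
  have "\<forall>f\<in>F. \<exists>B. \<forall>x\<in>X. \<bar>f x\<bar> \<le> B"
    using continuous_on_compact_bound[OF X F(2)] by metis
  then obtain b where b: "\<And>f x. f \<in> F \<Longrightarrow> x \<in> X \<Longrightarrow> \<bar>f x\<bar> \<le> b f" by metis
  \<comment> \<open>The inserted 0 gives the maximum a meaning for empty \<open>F\<close> and makes
    \<open>B\<close> nonnegative.\<close>
  define B where "B = Max (insert 0 (b ` F))"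
  have "B \<ge> 0" using F(1) by (simp add: B_def)
  moreover have "\<bar>f x\<bar> \<le> B" if "f \<in> F" "x \<in> X" for f x
    unfolding B_def using b[OF that] that(1) F(1) by (intro order_trans[OF _ Max_ge]) auto
  ultimately show ?thesis by blast
qed

lemma integrable_continuous_on_carrier:
  fixes f :: "'a::metric_space \<Rightarrow> real"
  assumes "\<mu> \<in> borel_prob_measures X" "compact X" "continuous_on X f"
  shows "integrable \<mu> f"
proof -
  interpret prob_space \<mu> using assms(1) by (simp add: borel_prob_measures_def)
  obtain B where "\<And>x. x \<in> X \<Longrightarrow> \<bar>f x\<bar> \<le> B"
    using continuous_on_compact_bound[OF assms(2,3)] by blast
  then show ?thesis
    using borel_measurable_continuous_on_carrier[OF assms(1,3)] space_borel_prob_measures[OF assms(1)]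
    by (intro integrable_const_bound[of _ B]) auto
qed

lemma integral_invariant_comp:
  fixes f :: "'a::metric_space \<Rightarrow> real"
  assumes "\<mu> \<in> invariant_measures X T" "continuous_on X T" "T ` X \<subseteq> X" "f \<in> borel_measurable \<mu>"
  shows "(\<integral>x. f (T x) \<partial>\<mu>) = (\<integral>x. f x \<partial>\<mu>)"
proof -
  have \<mu>: "\<mu> \<in> borel_prob_measures X" using assms(1) by (simp add: invariant_measures_def)
  then interpret prob_space \<mu> by (simp add: borel_prob_measures_def)
  have T: "T \<in> measurable \<mu> \<mu>" by (rule measurable_self_map[OF \<mu> assms(2,3)])
  have "distr \<mu> \<mu> T = \<mu>"
  proof (rule measure_eqI)
    fix A assume "A \<in> sets (distr \<mu> \<mu> T)"
    then show "emeasure (distr \<mu> \<mu> T) A = emeasure \<mu> A"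
      using assms(1) T space_borel_prob_measures[OF \<mu>]
      by (simp add: emeasure_distr emeasure_eq_measure invariant_measures_def)
  qed simp
  then show ?thesis using integral_distr[OF T assms(4)] by simp
qed

lemma integral_invariant_funpow:
  fixes f :: "'a::metric_space \<Rightarrow> real"
  assumes "\<mu> \<in> invariant_measures X T" "continuous_on X T" "T ` X \<subseteq> X" "f \<in> borel_measurable \<mu>"
  shows "(\<integral>x. f ((T ^^ n) x) \<partial>\<mu>) = (\<integral>x. f x \<partial>\<mu>)"
  using assms(4)
proof (induction n arbitrary: f)
  case (Suc n)
  have "T \<in> measurable \<mu> \<mu>"
    using assms by (intro measurable_self_map) (auto simp: invariant_measures_def)
  then have "(\<lambda>x. f (T x)) \<in> borel_measurable \<mu>"
    using Suc.prems by (rule measurable_compose)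
  then show ?case
    using Suc.IH[of "\<lambda>x. f (T x)"] integral_invariant_comp[OF assms(1-3) Suc.prems] by simp
qed simp

text \<open>Disjointify a cover by small balls and round the weights of its pieces.\<close>

lemma integral_approx_finite_average:
  fixes F :: "('a::metric_space \<Rightarrow> real) set"
  assumes \<mu>: "\<mu> \<in> borel_prob_measures X" and X: "compact X"
    and F: "finite F" "\<And>f. f \<in> F \<Longrightarrow> continuous_on X f" and "e > 0"
  shows "\<exists>ys. ys \<noteq> [] \<and> set ys \<subseteq> X \<and>
    (\<forall>f\<in>F. \<bar>(\<Sum>y\<leftarrow>ys. f y) / length ys - (\<integral>x. f x \<partial>\<mu>)\<bar> < e)"
proof -
  interpret prob_space \<mu> using \<mu> by (simp add: borel_prob_measures_def)
  have space: "space \<mu> = X" by (rule space_borel_prob_measures[OF \<mu>])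
  have "\<exists>d>0. \<forall>x\<in>X. \<forall>y\<in>X. dist x y < d \<longrightarrow> \<bar>f x - f y\<bar> < e / 2" if "f \<in> F" for f
  proof -
    have "uniformly_continuous_on X f" using compact_uniformly_continuous[OF F(2)[OF that] X] .
    then obtain d where "d > 0" "\<And>x y. x \<in> X \<Longrightarrow> y \<in> X \<Longrightarrow> dist y x < d \<Longrightarrow> dist (f y) (f x) < e / 2"
      using \<open>e > 0\<close> unfolding uniformly_continuous_on_def by (metis half_gt_zero)
    then show ?thesis by (auto simp: dist_real_def)
  qed
  then obtain d where d: "\<And>f. f \<in> F \<Longrightarrow> d f > 0"
      "\<And>f x y. f \<in> F \<Longrightarrow> x \<in> X \<Longrightarrow> y \<in> X \<Longrightarrow> dist x y < d f \<Longrightarrow> \<bar>f x - f y\<bar> < e / 2"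
    by metis
  define r where "r = Min (insert 1 (d ` F))"
  have r: "r > 0" "\<And>f. f \<in> F \<Longrightarrow> r \<le> d f"
    using F(1) d(1) by (auto simp: r_def)
  obtain C where C: "finite C" "C \<subseteq> X" "X \<subseteq> (\<Union>c\<in>C. ball c r)"
    using seq_compact_imp_totally_bounded[OF compact_imp_seq_compact[OF X]] r(1) by metis
  obtain cs where cs: "set cs = C" using finite_list[OF C(1)] by blast
  define p where "p = length cs"
  \<comment> \<open>The first ball that contains \<open>x\<close>: the fibres \<open>P j\<close> of
    \<phi> are the disjoint pieces, and a least index is measurable because the condition on each
    \<open>j\<close> is.\<close>
  define \<phi> where "\<phi> x = (LEAST j. j < p \<and> dist (cs ! j) x < r)" for x
  have \<phi>: "\<phi> x < p \<and> dist (cs ! \<phi> x) x < r" if x: "x \<in> X" for x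
  proof -
    obtain c where "c \<in> C" "dist c x < r" using subsetD[OF C(3) x] by auto
    moreover from this cs obtain j where "j < length cs" "cs ! j = c"
      by (metis in_set_conv_nth)
    ultimately have "j < p \<and> dist (cs ! j) x < r" by (simp add: p_def)
    then show ?thesis unfolding \<phi>_def by (rule LeastI)
  qed
  have "Measurable.pred \<mu> (\<lambda>x. j < p \<and> dist (cs ! j) x < r)" for j
  proof -
    have "(\<lambda>x. dist (cs ! j) x) \<in> borel_measurable \<mu>"
      by (intro borel_measurable_continuous_on_carrier[OF \<mu>] continuous_intros)
    then have "Measurable.pred \<mu> (\<lambda>x. dist (cs ! j) x < r)"
      by (intro borel_measurable_pred_less borel_measurable_const)
    then show ?thesis by (cases "j < p") auto
  qed
  then have \<phi>_meas: "\<phi> \<in> measurable \<mu> (count_space UNIV)"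
    unfolding \<phi>_def by (intro measurable_Least)
  define P where "P j = {x \<in> X. \<phi> x = j}" for j
  have P_sets: "P j \<in> sets \<mu>" for j
  proof -
    have "\<phi> -` {j} \<inter> space \<mu> \<in> sets \<mu>" by (rule measurable_sets[OF \<phi>_meas]) simp
    moreover have "\<phi> -` {j} \<inter> space \<mu> = P j" by (auto simp: P_def space)
    ultimately show ?thesis by simp
  qed
  have cs_X: "cs ! j \<in> X" if "j < p" for j
    using that C(2) cs by (auto simp: p_def)
  have step: "(\<integral>x. f (cs ! \<phi> x) \<partial>\<mu>) = (\<Sum>j<p. measure \<mu> (P j) * f (cs ! j))"
    and step_int: "integrable \<mu> (\<lambda>x. f (cs ! \<phi> x))" for f :: "'a \<Rightarrow> real"
  proof -
    have eq: "f (cs ! \<phi> x) = (\<Sum>j<p. f (cs ! j) * indicator (P j) x)" if "x \<in> space \<mu>" for x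
    proof -
      have "(\<Sum>j<p. f (cs ! j) * indicator (P j) x) = (\<Sum>j<p. if j = \<phi> x then f (cs ! j) else 0)"
        using that by (intro sum.cong) (auto simp: P_def space)
      then show ?thesis using \<phi>[of x] that by (simp add: space)
    qed
    have int: "integrable \<mu> (\<lambda>x. f (cs ! j) * indicator (P j) x)" for j
      using P_sets by (auto intro!: integrable_mult_right integrable_real_indicator simp: emeasure_eq_measure)
    have "(\<integral>x. f (cs ! \<phi> x) \<partial>\<mu>) = (\<integral>x. (\<Sum>j<p. f (cs ! j) * indicator (P j) x) \<partial>\<mu>)"
      by (intro Bochner_Integration.integral_cong eq refl)
    also have "\<dots> = (\<Sum>j<p. \<integral>x. f (cs ! j) * indicator (P j) x \<partial>\<mu>)"
      using int by (intro Bochner_Integration.integral_sum)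
    also have "\<dots> = (\<Sum>j<p. measure \<mu> (P j) * f (cs ! j))"
      by (simp add: mult.commute sets.Int_space_eq2[OF P_sets] del: sets.Int_space_eq2)
    finally show "(\<integral>x. f (cs ! \<phi> x) \<partial>\<mu>) = (\<Sum>j<p. measure \<mu> (P j) * f (cs ! j))" .
    show "integrable \<mu> (\<lambda>x. f (cs ! \<phi> x))"
      by (subst Bochner_Integration.integrable_cong[OF refl eq]) (assumption, intro Bochner_Integration.integrable_sum int)
  qed
  have total: "(\<Sum>j<p. measure \<mu> (P j)) = 1"
    using step[of "\<lambda>_. 1"] by (simp add: prob_space)
  obtain B where B: "B \<ge> 0" "\<And>f x. f \<in> F \<Longrightarrow> x \<in> X \<Longrightarrow> \<bar>f x\<bar> \<le> B"
    using finite_continuous_family_bound[OF X F] by metis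
  \<comment> \<open>Rounding down the weights \<open>L * measure \<mu> (P j)\<close> costs at most 1
    per piece: at most \<open>p * B\<close> in the sum and \<open>p\<close> in the number of points.
    The total \<open>2 * p * B\<close> stays below \<open>(e / 2) * (L - p)\<close>, hence below
    \<open>(e / 2) * K\<close>. The other half of \<open>e\<close> pays for moving each point to the
    centre of its ball.\<close>
  obtain L :: nat where L: "real L > p + 4 * p * B / e"
    using reals_Archimedean2 by blast
  define k where "k j = nat \<lfloor>L * measure \<mu> (P j)\<rfloor>" for j
  have k: "real (k j) \<le> L * measure \<mu> (P j)" "L * measure \<mu> (P j) - k j \<le> 1" for j
  proof -
    have "real (k j) = of_int \<lfloor>L * measure \<mu> (P j)\<rfloor>" by (simp add: k_def)
    then show "real (k j) \<le> L * measure \<mu> (P j)" "L * measure \<mu> (P j) - k j \<le> 1" by linarith+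
  qed
  define ys where "ys = concat (map (\<lambda>j. replicate (k j) (cs ! j)) [0..<p])"
  have sum_ys: "(\<Sum>y\<leftarrow>ys. f y) = (\<Sum>j<p. k j * f (cs ! j))" for f :: "'a \<Rightarrow> real"
  proof -
    have "(\<Sum>y\<leftarrow>concat (map (\<lambda>j. replicate (k j) (cs ! j)) js). f y) = (\<Sum>j\<leftarrow>js. k j * f (cs ! j))" for js
      by (induction js) (auto simp: sum_list_replicate)
    then show ?thesis by (simp add: ys_def interv_sum_list_conv_sum_set_nat atLeast0LessThan)
  qed
  define K where "K = length ys"
  have K: "real K = (\<Sum>j<p. real (k j))"
    using sum_ys[of "\<lambda>_. 1"] by (simp add: K_def sum_list_triv)
  \<comment> \<open>Used twice: for the values of \<open>f\<close> at the centres, and for the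
    constant 1, which controls the number \<open>K\<close> of sample points.\<close>
  have error: "\<bar>(\<Sum>j<p. k j * g j) - L * (\<Sum>j<p. measure \<mu> (P j) * g j)\<bar> \<le> p * b"
    if "\<And>j. j < p \<Longrightarrow> \<bar>g j\<bar> \<le> b" for g :: "nat \<Rightarrow> real" and b :: real
  proof -
    have "\<bar>(\<Sum>j<p. k j * g j) - L * (\<Sum>j<p. measure \<mu> (P j) * g j)\<bar>
        = \<bar>\<Sum>j<p. (k j - L * measure \<mu> (P j)) * g j\<bar>"
      by (simp add: sum_distrib_left sum_subtractf algebra_simps)
    also have "\<dots> \<le> (\<Sum>j<p. \<bar>(k j - L * measure \<mu> (P j)) * g j\<bar>)" by (rule sum_abs)
    also have "\<dots> \<le> (\<Sum>j<p. b)"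
    proof (rule sum_mono)
      fix j assume "j \<in> {..<p}"
      then have "\<bar>k j - L * measure \<mu> (P j)\<bar> * \<bar>g j\<bar> \<le> 1 * b"
        using k[of j] that[of j] by (intro mult_mono) auto
      then show "\<bar>(k j - L * measure \<mu> (P j)) * g j\<bar> \<le> b" by (simp add: abs_mult)
    qed
    finally show ?thesis by simp
  qed
  have K_L: "\<bar>real K - L\<bar> \<le> p" using error[of "\<lambda>_. 1" 1] by (simp add: K total)
  have Le: "4 * p * B < e * (real L - p)"
    using L \<open>e > 0\<close> by (simp add: field_simps)
  have "p > 0" using total by (cases "p = 0") auto
  have "4 * p * B / e \<ge> 0" using B(1) \<open>e > 0\<close> by simp
  then have "L > p" using L by linarith
  then have K_pos: "real K > 0" using K_L by linarith
  have "\<bar>(\<Sum>y\<leftarrow>ys. f y) / K - (\<integral>x. f x \<partial>\<mu>)\<bar> < e" if f: "f \<in> F" for f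
  proof -
    define I where "I = (\<Sum>j<p. measure \<mu> (P j) * f (cs ! j))"
    have "\<bar>I\<bar> \<le> (\<Sum>j<p. measure \<mu> (P j) * B)"
      unfolding I_def using B(2)[OF f cs_X]
      by (intro order_trans[OF sum_abs] sum_mono) (auto simp: abs_mult intro!: mult_left_mono)
    then have I: "\<bar>I\<bar> \<le> B" by (simp add: total flip: sum_distrib_right)
    have "(\<Sum>y\<leftarrow>ys. f y) - K * I = ((\<Sum>y\<leftarrow>ys. f y) - L * I) - (real K - L) * I"
      by (simp add: algebra_simps)
    then have "\<bar>(\<Sum>y\<leftarrow>ys. f y) - K * I\<bar> \<le> \<bar>(\<Sum>y\<leftarrow>ys. f y) - L * I\<bar> + \<bar>real K - L\<bar> * \<bar>I\<bar>"
      by (metis abs_triangle_ineq4 abs_mult)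
    also have "\<dots> \<le> p * B + p * B"
      using error[of "\<lambda>j. f (cs ! j)" B] B(2)[OF f cs_X] K_L I unfolding sum_ys I_def
      by (intro add_mono mult_mono) auto
    also have "\<dots> < (e / 2) * (real L - p)" using Le by (simp add: algebra_simps)
    also have "\<dots> \<le> (e / 2) * K" using K_L \<open>e > 0\<close> by (intro mult_left_mono) auto
    finally have "\<bar>((\<Sum>y\<leftarrow>ys. f y) - K * I) / K\<bar> < e / 2"
      using K_pos by (simp add: abs_divide divide_less_eq)
    then have "\<bar>(\<Sum>y\<leftarrow>ys. f y) / K - I\<bar> < e / 2" using K_pos by (simp add: diff_divide_distrib)
    moreover have "\<bar>I - (\<integral>x. f x \<partial>\<mu>)\<bar> \<le> e / 2"
    proof -
      have int: "integrable \<mu> f" by (rule integrable_continuous_on_carrier[OF \<mu> X F(2)[OF f]])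
      have "I - (\<integral>x. f x \<partial>\<mu>) = (\<integral>x. f (cs ! \<phi> x) - f x \<partial>\<mu>)"
        using step[of f] step_int[of f] int by (simp add: I_def)
      also have "\<bar>\<dots>\<bar> \<le> (\<integral>x. \<bar>f (cs ! \<phi> x) - f x\<bar> \<partial>\<mu>)"
        by (rule integral_abs_bound)
      also have "\<dots> \<le> (\<integral>x. e / 2 \<partial>\<mu>)"
      proof (rule integral_mono)
        show "\<bar>f (cs ! \<phi> x) - f x\<bar> \<le> e / 2" if "x \<in> space \<mu>" for x
          using d(2)[OF f, of "cs ! \<phi> x" x] \<phi>[of x] that r(2)[OF f] cs_X[of "\<phi> x"]
          by (auto simp: space intro!: less_imp_le)
      qed (use int step_int[of f] in auto)
      finally show ?thesis by (simp add: prob_space)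
    qed
    ultimately show ?thesis by linarith
  qed
  moreover have "ys \<noteq> []" using K_pos by (auto simp: K_def)
  moreover have "set ys \<subseteq> X" using cs_X by (auto simp: ys_def)
  ultimately show ?thesis unfolding K_def by blast
qed

section \<open>Approximation by periodic pseudo-orbits\<close>

text \<open>Transitivity gives a time for each pair of open sets without any bound. A finite net
  leaves only finitely many pairs of balls, and \<open>M\<close> is the largest of their
  times.\<close>

lemma transitive_bounded_chains:
  fixes T :: "'a::metric_space \<Rightarrow> 'a"
  assumes X: "compact X" and trans: "transitive_system X T" and "\<delta> > 0"
  obtains M :: nat where "\<And>x y. x \<in> X \<Longrightarrow> y \<in> X \<Longrightarrow>
    \<exists>u\<in>X. \<exists>n>0. n \<le> M \<and> dist x u < \<delta> \<and> dist ((T ^^ n) u) y < \<delta>"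
proof -
  obtain C where C: "finite C" "C \<subseteq> X" "X \<subseteq> (\<Union>c\<in>C. ball c (\<delta> / 2))"
    using seq_compact_imp_totally_bounded[OF compact_imp_seq_compact[OF X]] \<open>\<delta> > 0\<close>
    by (metis half_gt_zero)
  have "\<exists>n>0. \<exists>u\<in>X. dist a u < \<delta> / 2 \<and> dist ((T ^^ n) u) b < \<delta> / 2" if "a \<in> C" "b \<in> C" for a b
  proof -
    define U where "U c = X \<inter> ball c (\<delta> / 2)" for c
    have "openin (top_of_set X) (U c)" for c by (simp add: U_def openin_open_Int)
    moreover have "U a \<noteq> {}" "U b \<noteq> {}" using that C(2) \<open>\<delta> > 0\<close> by (auto simp: U_def)
    ultimately have "\<exists>n>0. (T ^^ n) ` U a \<inter> U b \<noteq> {}"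
      using trans[unfolded transitive_system_def, rule_format, of "U a" "U b"] by simp
    then obtain n u where "n > 0" "u \<in> U a" "(T ^^ n) u \<in> U b" by blast
    then show ?thesis by (intro exI[of _ n] conjI bexI[of _ u]) (auto simp: U_def dist_commute)
  qed
  then have "\<forall>a b. \<exists>n. a \<in> C \<longrightarrow> b \<in> C \<longrightarrow> n > 0 \<and>
      (\<exists>u\<in>X. dist a u < \<delta> / 2 \<and> dist ((T ^^ n) u) b < \<delta> / 2)"
    by meson
  then obtain n where n: "\<And>a b. a \<in> C \<Longrightarrow> b \<in> C \<Longrightarrow> n a b > 0 \<and>
      (\<exists>u\<in>X. dist a u < \<delta> / 2 \<and> dist ((T ^^ n a b) u) b < \<delta> / 2)"
    by metis
  define M where "M = Max ((\<lambda>(a, b). n a b) ` (C \<times> C))"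
  have "\<exists>u\<in>X. \<exists>n>0. n \<le> M \<and> dist x u < \<delta> \<and> dist ((T ^^ n) u) y < \<delta>" if xy: "x \<in> X" "y \<in> X" for x y
  proof -
    obtain a b where ab: "a \<in> C" "dist a x < \<delta> / 2" "b \<in> C" "dist b y < \<delta> / 2"
      using subsetD[OF C(3) xy(1)] subsetD[OF C(3) xy(2)] by auto
    obtain u where u: "u \<in> X" "dist a u < \<delta> / 2" "dist ((T ^^ n a b) u) b < \<delta> / 2"
      using n[OF ab(1,3)] by blast
    have "n a b \<le> M" unfolding M_def using C(1) ab by (intro Max_ge) auto
    moreover have "dist x u < \<delta>"
      using dist_triangle2[of x u a] ab(2) u(2) by (simp add: dist_commute)
    moreover have "dist ((T ^^ n a b) u) y < \<delta>"
      using dist_triangle[of "(T ^^ n a b) u" y b] ab(4) u(3) by simp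
    ultimately show ?thesis using n[OF ab(1,3)] u(1) by blast
  qed
  then show ?thesis using that by blast
qed

section \<open>Closed chains through a base point, as lists\<close>

definition orbit_list :: "('a \<Rightarrow> 'a) \<Rightarrow> 'a \<Rightarrow> nat \<Rightarrow> 'a list" where
  "orbit_list T u n = map (\<lambda>i. (T ^^ i) u) [0..<n]"

lemma length_orbit_list [simp]: "length (orbit_list T u n) = n"
  by (simp add: orbit_list_def)

lemma orbit_list_eq_Nil [simp]: "orbit_list T u n = [] \<longleftrightarrow> n = 0"
  by (simp add: orbit_list_def)

lemma hd_orbit_list [simp]: "n > 0 \<Longrightarrow> hd (orbit_list T u n) = u"
  by (simp add: orbit_list_def hd_map)

lemma last_orbit_list: "n > 0 \<Longrightarrow> T (last (orbit_list T u n)) = (T ^^ n) u"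
  by (cases n) (simp_all add: orbit_list_def)

lemma sum_list_orbit_list: "(\<Sum>x\<leftarrow>orbit_list T u n. f x) = (\<Sum>i<n. f ((T ^^ i) u))"
  by (simp add: orbit_list_def o_def interv_sum_list_conv_sum_set_nat atLeast0LessThan)

lemma set_orbit_list_subset:
  assumes "T ` X \<subseteq> X" "u \<in> X"
  shows "set (orbit_list T u n) \<subseteq> X"
  using funpow_in_invariant_set[OF assms] by (auto simp: orbit_list_def)

text \<open>A finite pseudo-orbit. As a list it can be cut and concatenated; membership in
  \<open>X\<close> is left to \<open>chain_loop\<close>.\<close>

definition chain_list :: "('a::metric_space \<Rightarrow> 'a) \<Rightarrow> real \<Rightarrow> 'a list \<Rightarrow> bool" where
  "chain_list T \<delta> = successively (\<lambda>a b. dist (T a) b < \<delta>)"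

lemma chain_list_append:
  "chain_list T \<delta> (xs @ ys) \<longleftrightarrow> chain_list T \<delta> xs \<and> chain_list T \<delta> ys \<and>
     (xs = [] \<or> ys = [] \<or> dist (T (last xs)) (hd ys) < \<delta>)"
  by (simp add: chain_list_def successively_append_iff)

lemma chain_list_Cons:
  "chain_list T \<delta> (x # xs) \<longleftrightarrow> xs = [] \<or> dist (T x) (hd xs) < \<delta> \<and> chain_list T \<delta> xs"
  by (simp add: chain_list_def successively_Cons)

lemma chain_list_singleton [simp]: "chain_list T \<delta> [x]"
  by (simp add: chain_list_def)

lemma chain_list_orbit_list: "\<delta> > 0 \<Longrightarrow> chain_list T \<delta> (orbit_list T u n)"
proof (induction n)
  case (Suc n)
  have "orbit_list T u (Suc n) = orbit_list T u n @ [(T ^^ n) u]" by (simp add: orbit_list_def)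
  then show ?case using Suc last_orbit_list[of n T u] by (cases "n = 0") (auto simp: chain_list_append)
qed (simp add: orbit_list_def chain_list_def)

text \<open>The return to \<open>p\<close> is appended only to state the closing jump. It is not
  part of \<open>xs\<close>, so \<open>length xs\<close> is the period.\<close>

definition chain_loop :: "'a::metric_space set \<Rightarrow> ('a \<Rightarrow> 'a) \<Rightarrow> real \<Rightarrow> 'a \<Rightarrow> 'a list \<Rightarrow> bool" where
  "chain_loop X T \<delta> p xs \<longleftrightarrow> xs \<noteq> [] \<and> set xs \<subseteq> X \<and> hd xs = p \<and> chain_list T \<delta> (xs @ [p])"

text \<open>All loops start at the same \<open>p\<close>, so the closing jump of one loop is also
  the jump onto the head of the next.\<close>

lemma chain_loop_append:
  "chain_loop X T \<delta> p xs \<Longrightarrow> chain_loop X T \<delta> p ys \<Longrightarrow> chain_loop X T \<delta> p (xs @ ys)"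
  by (auto simp: chain_loop_def chain_list_append)

lemma chain_loop_concat:
  assumes "\<And>y. y \<in> set ys \<Longrightarrow> chain_loop X T \<delta> p (l y)" "ys \<noteq> []"
  shows "chain_loop X T \<delta> p (concat (map l ys))"
  using assms
proof (induction ys)
  case (Cons y ys)
  then show ?case by (cases "ys = []") (auto intro: chain_loop_append)
qed simp

lemma chain_loop_imp_periodic_pseudo_orbit:
  assumes "chain_loop X T \<delta> p xs"
  shows "pseudo_orbit X T \<delta> (\<lambda>i. xs ! (i mod length xs))"
proof -
  define n where "n = length xs"
  have n: "n > 0" and p: "xs ! 0 = p" and chain: "chain_list T \<delta> (xs @ [p])" and X: "set xs \<subseteq> X"
    using assms by (auto simp: chain_loop_def n_def hd_conv_nth)
  \<comment> \<open>With \<open>p\<close> appended, the closing jump becomes an ordinary step of the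
    list.\<close>
  define ws where "ws = xs @ [p]"
  have step: "dist (T (ws ! i)) (ws ! Suc i) < \<delta>" if "i < n" for i
  proof -
    have i: "Suc i < length ws" using that by (simp add: ws_def n_def)
    have "chain_list T \<delta> (take (Suc i) ws @ drop (Suc i) ws)" using chain by (simp only: ws_def append_take_drop_id)
    then have "dist (T (last (take (Suc i) ws))) (hd (drop (Suc i) ws)) < \<delta>"
      using i unfolding chain_list_append by auto
    then show ?thesis using i by (simp add: take_Suc_conv_app_nth hd_drop_conv_nth)
  qed
  have "dist (T (xs ! (i mod n))) (xs ! (Suc i mod n)) < \<delta>" for i
  proof (cases "Suc (i mod n) = n")
    case True
    then have "Suc i mod n = 0" by (simp add: mod_Suc)
    then show ?thesis using step[of "i mod n"] True n p by (simp add: ws_def nth_append n_def)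
  next
    case False
    then have "Suc i mod n = Suc (i mod n)" by (simp add: mod_Suc)
    moreover have "Suc (i mod n) < n" using False n by (meson Suc_lessI mod_less_divisor)
    ultimately show ?thesis using step[of "i mod n"] by (simp add: ws_def nth_append n_def)
  qed
  moreover have "xs ! (i mod n) \<in> X" for i
    using X n by (simp add: n_def subset_iff)
  ultimately show ?thesis by (simp add: pseudo_orbit_def n_def)
qed

text \<open>The loop consists of \<open>p\<close>, a connecting segment to \<open>y\<close>, the
  \<open>N\<close> points of the orbit of \<open>y\<close>, and a connecting segment back to
  \<open>p\<close>. The points outside the orbit of \<open>y\<close> number at most
  \<open>2 * M + 1\<close>, the 1 being \<open>p\<close> itself. The estimate is for all
  \<open>f\<close> and \<open>B\<close>, so one loop serves every test function.\<close>

lemma chain_loop_through_orbit: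
  fixes T :: "'a::metric_space \<Rightarrow> 'a"
  assumes TX: "T ` X \<subseteq> X" and "\<delta> > 0"
    and M: "\<And>x y. x \<in> X \<Longrightarrow> y \<in> X \<Longrightarrow>
      \<exists>u\<in>X. \<exists>n>0. n \<le> M \<and> dist x u < \<delta> \<and> dist ((T ^^ n) u) y < \<delta>"
    and "p \<in> X" "y \<in> X" "N > 0"
  shows "\<exists>xs. chain_loop X T \<delta> p xs \<and> N \<le> length xs \<and> length xs \<le> N + (2 * M + 1) \<and>
    (\<forall>f B. (\<forall>x\<in>X. \<bar>f x\<bar> \<le> B) \<longrightarrow> \<bar>(\<Sum>x\<leftarrow>xs. f x) - (\<Sum>i<N. f ((T ^^ i) y))\<bar> \<le> real (2 * M + 1) * B)"
proof -
  \<comment> \<open>The chain is sought from \<open>T p\<close> because \<open>p\<close> is already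
    an entry of the loop, and its successor must be close to \<open>T p\<close>.\<close>
  obtain u m where u: "u \<in> X" "m > 0" "m \<le> M" "dist (T p) u < \<delta>" "dist ((T ^^ m) u) y < \<delta>"
    using M[OF funpow_in_invariant_set[OF TX \<open>p \<in> X\<close>, of 1] \<open>y \<in> X\<close>] by auto
  obtain v n where v: "v \<in> X" "n > 0" "n \<le> M" "dist ((T ^^ N) y) v < \<delta>" "dist ((T ^^ n) v) p < \<delta>"
    using M[OF funpow_in_invariant_set[OF TX \<open>y \<in> X\<close>, of N] \<open>p \<in> X\<close>] by blast
  define us where "us = [p] @ orbit_list T u m"
  define vs where "vs = orbit_list T v n"
  define xs where "xs = us @ orbit_list T y N @ vs"
  have sub: "set us \<subseteq> X" "set vs \<subseteq> X"
    using set_orbit_list_subset[OF TX] u(1) v(1) \<open>p \<in> X\<close> by (auto simp: us_def vs_def)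
  have "chain_loop X T \<delta> p xs"
    using u v \<open>N > 0\<close> \<open>\<delta> > 0\<close> sub set_orbit_list_subset[OF TX \<open>y \<in> X\<close>, of N]
    by (auto simp: chain_loop_def xs_def us_def vs_def chain_list_Cons chain_list_append chain_list_orbit_list last_orbit_list)
  moreover have len: "length us + length vs \<le> 2 * M + 1" using u(3) v(3) by (simp add: us_def vs_def)
  moreover have "\<bar>(\<Sum>x\<leftarrow>xs. f x) - (\<Sum>i<N. f ((T ^^ i) y))\<bar> \<le> real (2 * M + 1) * B"
    if B: "\<forall>x\<in>X. \<bar>f x\<bar> \<le> B" for f :: "'a \<Rightarrow> real" and B :: real
  proof -
    have bound: "\<bar>\<Sum>x\<leftarrow>zs. f x\<bar> \<le> length zs * B" if "set zs \<subseteq> X" for zs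
      using that
    proof (induction zs)
      case (Cons z zs)
      then have "\<bar>f z\<bar> \<le> B" "\<bar>\<Sum>x\<leftarrow>zs. f x\<bar> \<le> length zs * B" using B by auto
      then show ?case by (simp add: algebra_simps)
    qed simp
    have "B \<ge> 0" using B \<open>p \<in> X\<close> by force
    have "\<bar>(\<Sum>x\<leftarrow>xs. f x) - (\<Sum>i<N. f ((T ^^ i) y))\<bar> = \<bar>(\<Sum>x\<leftarrow>us @ vs. f x)\<bar>"
      by (simp add: xs_def sum_list_orbit_list)
    also have "\<dots> \<le> length (us @ vs) * B" using sub by (intro bound) auto
    also have "\<dots> \<le> real (2 * M + 1) * B" using len \<open>B \<ge> 0\<close> by (intro mult_right_mono) auto
    finally show ?thesis .
  qed
  moreover have "N \<le> length xs" "length xs \<le> N + (2 * M + 1)" using len by (auto simp: xs_def)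
  ultimately show ?thesis by (intro exI[of _ xs] conjI allI impI)
qed

lemma invariant_measure_approx_periodic_pseudo_orbit:
  fixes T :: "'a::metric_space \<Rightarrow> 'a" and F :: "('a \<Rightarrow> real) set"
  assumes sys: "dynamical_system X T" and trans: "transitive_system X T"
    and \<mu>: "\<mu> \<in> invariant_measures X T"
    and F: "finite F" "\<And>f. f \<in> F \<Longrightarrow> continuous_on X f" and "e > 0" "\<delta> > 0"
  shows "\<exists>x n. n > 0 \<and> pseudo_orbit X T \<delta> x \<and> (\<forall>i. x (i + n) = x i) \<and>
    (\<forall>f\<in>F. \<bar>(\<Sum>i<n. f (x i)) / n - (\<integral>x. f x \<partial>\<mu>)\<bar> < e)"
proof -
  have X: "compact X" "continuous_on X T" "T ` X \<subseteq> X" using sys by (auto simp: dynamical_system_def)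
  have \<mu>': "\<mu> \<in> borel_prob_measures X" using \<mu> by (simp add: invariant_measures_def)
  then interpret prob_space \<mu> by (simp add: borel_prob_measures_def)
  obtain p where "p \<in> X" using not_empty space_borel_prob_measures[OF \<mu>'] by auto
  obtain M :: nat where M: "\<And>x y. x \<in> X \<Longrightarrow> y \<in> X \<Longrightarrow>
      \<exists>u\<in>X. \<exists>n>0. n \<le> M \<and> dist x u < \<delta> \<and> dist ((T ^^ n) u) y < \<delta>"
    using transitive_bounded_chains[OF X(1) trans \<open>\<delta> > 0\<close>] by blast
  define D where "D = 2 * M + 1"
  obtain B :: real where B: "B \<ge> 0" "\<And>f x. f \<in> F \<Longrightarrow> x \<in> X \<Longrightarrow> \<bar>f x\<bar> \<le> B"
    using finite_continuous_family_bound[OF X(1) F] by metis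
  \<comment> \<open>Per loop, the connecting points cost at most \<open>D * B\<close> in the sum,
    and the surplus length costs \<open>D * B\<close> again. \<open>N\<close> is so large that both
    together are at most \<open>e / 2 * N\<close>.\<close>
  obtain N :: nat where N: "real N > 4 * D * B / e + 1" using reals_Archimedean2 by blast
  have "4 * D * B / e \<ge> 0" using B(1) \<open>e > 0\<close> by simp
  then have "N > 0" using N by (metis add_nonneg_pos gr0I less_numeral_extra(1) of_nat_0 order.asym)
  define g where "g f y = (\<Sum>i<N. f ((T ^^ i) y))" for f :: "'a \<Rightarrow> real" and y
  have g_cont: "continuous_on X (g f)" if "f \<in> F" for f
    unfolding g_def
  proof (intro continuous_on_sum)
    fix i
    show "continuous_on X (\<lambda>y. f ((T ^^ i) y))"
      by (rule continuous_on_compose2[OF F(2)[OF that] continuous_on_funpow[OF X(2,3)]])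
         (use funpow_in_invariant_set[OF X(3)] in auto)
  qed
  have g_int: "(\<integral>x. g f x \<partial>\<mu>) = N * (\<integral>x. f x \<partial>\<mu>)" if "f \<in> F" for f
  proof -
    have "f \<in> borel_measurable \<mu>"
      by (rule borel_measurable_continuous_on_carrier[OF \<mu>' F(2)[OF that]])
    moreover have "integrable \<mu> (\<lambda>x. f ((T ^^ i) x))" for i
      by (rule integrable_continuous_on_carrier[OF \<mu>' X(1)],
          rule continuous_on_compose2[OF F(2)[OF that] continuous_on_funpow[OF X(2,3)]])
         (use funpow_in_invariant_set[OF X(3)] in auto)
    ultimately show ?thesis
      unfolding g_def by (simp add: integral_invariant_funpow[OF \<mu> X(2,3)])
  qed
  \<comment> \<open>\<open>g f\<close> is a Birkhoff sum and not an average, hence a tolerance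
    scaled by \<open>N\<close>.\<close>
  have "e / 2 * N > 0" using \<open>e > 0\<close> \<open>N > 0\<close> by simp
  moreover have "continuous_on X h" if "h \<in> g ` F" for h using that g_cont by blast
  ultimately have "\<exists>ys. ys \<noteq> [] \<and> set ys \<subseteq> X \<and>
      (\<forall>h\<in>g ` F. \<bar>(\<Sum>y\<leftarrow>ys. h y) / length ys - (\<integral>x. h x \<partial>\<mu>)\<bar> < e / 2 * N)"
    using F(1) by (intro integral_approx_finite_average[OF \<mu>' X(1)]) auto
  then obtain ys where ys: "ys \<noteq> []" "set ys \<subseteq> X"
      "\<And>f. f \<in> F \<Longrightarrow> \<bar>(\<Sum>y\<leftarrow>ys. g f y) / length ys - (\<integral>x. g f x \<partial>\<mu>)\<bar> < e / 2 * N"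
    by blast
  have "\<exists>l. chain_loop X T \<delta> p l \<and> N \<le> length l \<and> length l \<le> N + D \<and>
    (\<forall>f B. (\<forall>x\<in>X. \<bar>f x\<bar> \<le> B) \<longrightarrow> \<bar>(\<Sum>x\<leftarrow>l. f x) - g f y\<bar> \<le> D * (B::real))" if "y \<in> X" for y
    using chain_loop_through_orbit[OF X(3) \<open>\<delta> > 0\<close> M \<open>p \<in> X\<close> that \<open>N > 0\<close>]
    unfolding D_def g_def by simp
  then obtain l where l: "\<And>y. y \<in> X \<Longrightarrow> chain_loop X T \<delta> p (l y)"
      "\<And>y. y \<in> X \<Longrightarrow> N \<le> length (l y)" "\<And>y. y \<in> X \<Longrightarrow> length (l y) \<le> N + D"
      "\<And>y f B. y \<in> X \<Longrightarrow> \<forall>x\<in>X. \<bar>f x\<bar> \<le> B \<Longrightarrow> \<bar>(\<Sum>x\<leftarrow>l y. f x) - g f y\<bar> \<le> D * (B::real)"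
    by metis
  define xs where "xs = concat (map l ys)"
  define n where "n = length xs"
  define L where "L = length ys"
  have "L > 0" using ys(1) by (simp add: L_def)
  have loop: "chain_loop X T \<delta> p xs"
    unfolding xs_def using ys l(1) by (intro chain_loop_concat) auto
  have "n > 0" using loop by (simp add: chain_loop_def n_def)
  have n: "L * N \<le> n" "n \<le> L * N + L * D"
  proof -
    have "length zs * N \<le> length (concat (map l zs)) \<and>
        length (concat (map l zs)) \<le> length zs * N + length zs * D" if "set zs \<subseteq> X" for zs
      using that
    proof (induction zs)
      case (Cons z zs)
      then show ?case using l(2)[of z] l(3)[of z] by (simp add: algebra_simps)
    qed simp
    then show "L * N \<le> n" "n \<le> L * N + L * D" using ys(2) by (auto simp: n_def xs_def L_def)
  qed
  have sums: "\<bar>(\<Sum>x\<leftarrow>xs. f x) - (\<Sum>y\<leftarrow>ys. g f y)\<bar> \<le> L * (D * B)" if f: "f \<in> F" for f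
  proof -
    have "\<bar>(\<Sum>x\<leftarrow>concat (map l zs). f x) - (\<Sum>y\<leftarrow>zs. g f y)\<bar> \<le> length zs * (D * B)" if "set zs \<subseteq> X" for zs
      using that
    proof (induction zs)
      case (Cons z zs)
      have "\<bar>(\<Sum>x\<leftarrow>l z. f x) - g f z\<bar> \<le> D * B" using l(4)[of z f B] B(2)[OF f] Cons.prems by simp
      moreover have "\<bar>(\<Sum>x\<leftarrow>concat (map l zs). f x) - (\<Sum>y\<leftarrow>zs. g f y)\<bar> \<le> length zs * (D * B)"
        using Cons by simp
      moreover have "length (z # zs) * (D * B) = D * B + length zs * (D * B)" by (simp add: algebra_simps)
      ultimately show ?case unfolding abs_le_iff by (simp add: algebra_simps)
    qed simp
    then show ?thesis using ys(2) by (simp add: xs_def L_def)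
  qed
  define x where "x = (\<lambda>i. xs ! (i mod n))"
  have "\<bar>(\<Sum>i<n. f (x i)) / n - (\<integral>x. f x \<partial>\<mu>)\<bar> < e" if f: "f \<in> F" for f
  proof -
    define I where "I = (\<integral>x. f x \<partial>\<mu>)"
    have sum_x: "(\<Sum>i<n. f (x i)) = (\<Sum>x\<leftarrow>xs. f x)"
      by (simp add: sum_list_sum_nth n_def x_def atLeast0LessThan)
    have I: "\<bar>I\<bar> \<le> B"
    proof -
      have "\<bar>I\<bar> \<le> (\<integral>x. \<bar>f x\<bar> \<partial>\<mu>)" unfolding I_def by (rule integral_abs_bound)
      also have "\<dots> \<le> (\<integral>x. B \<partial>\<mu>)"
        using integrable_continuous_on_carrier[OF \<mu>' X(1) F(2)[OF f]] B(2)[OF f]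
        by (intro integral_mono) (auto simp: space_borel_prob_measures[OF \<mu>'])
      finally show ?thesis by (simp add: prob_space)
    qed
    have "\<bar>(\<Sum>y\<leftarrow>ys. g f y) / L - N * I\<bar> < e / 2 * N"
      using ys(3)[OF f] g_int[OF f] by (simp add: L_def I_def)
    then have "\<bar>(\<Sum>y\<leftarrow>ys. g f y) / L - N * I\<bar> * L < e / 2 * N * L"
      using \<open>L > 0\<close> by (intro mult_strict_right_mono) auto
    moreover have "\<bar>(\<Sum>y\<leftarrow>ys. g f y) / L - N * I\<bar> * L = \<bar>(\<Sum>y\<leftarrow>ys. g f y) - L * N * I\<bar>"
    proof -
      have "((\<Sum>y\<leftarrow>ys. g f y) / L - N * I) * L = (\<Sum>y\<leftarrow>ys. g f y) - L * N * I"
        using \<open>L > 0\<close> by (simp add: field_simps)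
      then show ?thesis by (metis abs_mult abs_of_nat)
    qed
    ultimately have 1: "\<bar>(\<Sum>y\<leftarrow>ys. g f y) - L * N * I\<bar> < e / 2 * (L * N)" by (simp add: mult_ac)
    have 2: "\<bar>real n * I - L * N * I\<bar> \<le> L * D * B"
    proof -
      have "real (L * N) \<le> real n" "real n \<le> real (L * N + L * D)"
        using n by (simp_all only: of_nat_le_iff)
      then have "\<bar>real n - L * N\<bar> * \<bar>I\<bar> \<le> (L * D) * B" using I B(1) by (intro mult_mono) auto
      then show ?thesis by (simp add: left_diff_distrib flip: abs_mult)
    qed
    have 3: "2 * (L * D * B) \<le> e / 2 * (L * N)"
    proof -
      have "4 * D * B \<le> e * N" using N \<open>e > 0\<close> by (simp add: field_simps)
      then have "4 * D * B * L \<le> e * N * L" by (intro mult_right_mono) auto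
      then show ?thesis by (simp add: algebra_simps)
    qed
    \<comment> \<open>Three errors add up: the sampling of \<mu> (\<open>1\<close>), the connecting
      points (\<open>sums\<close>) and the surplus length \<open>n - L * N\<close>
      (\<open>2\<close>). By \<open>3\<close> the last two take at most half of the
      allowance.\<close>
    have "\<bar>(\<Sum>x\<leftarrow>xs. f x) - n * I\<bar> < e * (L * N)" using 1 2 3 sums[OF f] unfolding of_nat_mult mult.assoc by linarith
    also have "\<dots> \<le> e * n" using n(1) \<open>e > 0\<close> by (intro mult_left_mono) (auto simp flip: of_nat_mult)
    finally have "\<bar>((\<Sum>x\<leftarrow>xs. f x) - n * I) / n\<bar> < e"
      using \<open>n > 0\<close> by (simp add: abs_divide divide_less_eq)
    then show ?thesis using \<open>n > 0\<close> by (simp add: sum_x I_def diff_divide_distrib)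
  qed
  moreover have "pseudo_orbit X T \<delta> x"
    unfolding x_def n_def by (rule chain_loop_imp_periodic_pseudo_orbit[OF loop])
  moreover have "x (i + n) = x i" for i by (simp add: x_def)
  ultimately show ?thesis using \<open>n > 0\<close> by blast
qed

section \<open>Odometers\<close>

text \<open>The closure of the orbit of \<open>z\<close> is the odometer with periods \<open>n k\<close>.\<close>

locale nested_almost_periods =
  fixes X :: "'a::metric_space set" and T :: "'a \<Rightarrow> 'a" and z :: 'a
    and n :: "nat \<Rightarrow> nat" and \<eta> :: "nat \<Rightarrow> real"
  assumes compact_X: "compact X" and cont_T: "continuous_on X T" and T_X: "T ` X \<subseteq> X"
    and z_X: "z \<in> X"
    and n_pos: "\<And>k. n k > 0" and n_dvd_Suc: "\<And>k. n k dvd n (Suc k)"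
    and near: "\<And>k i j. i mod n k = j mod n k \<Longrightarrow> dist ((T ^^ i) z) ((T ^^ j) z) \<le> \<eta> k"
    and \<eta>_lim: "\<eta> \<longlonglongrightarrow> 0"
begin

definition orbit_closure :: "'a set" where
  "orbit_closure = closure (range (\<lambda>i. (T ^^ i) z))"

text \<open>The analogue of a cylinder set of an odometer. Different residues may give the same set,
  for instance if \<open>z\<close> is a fixed point.\<close>

definition cyl :: "nat \<Rightarrow> nat \<Rightarrow> 'a set" where
  "cyl k r = closure {(T ^^ i) z | i. i mod n k = r mod n k}"

lemma n_dvd: "k \<le> l \<Longrightarrow> n k dvd n l"
  by (induction l rule: dec_induct) (auto intro: dvd_trans n_dvd_Suc)

lemma \<eta>_small:
  assumes "e > 0"
  obtains l where "l \<ge> k" "\<eta> l < e"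
proof -
  have "\<forall>\<^sub>F l in sequentially. \<eta> l < e \<and> l \<ge> k"
    using order_tendstoD(2)[OF \<eta>_lim assms] eventually_ge_at_top[of k] by (rule eventually_conj)
  then show ?thesis using that by (auto simp: eventually_sequentially)
qed

lemma orbit_in_X: "(T ^^ i) z \<in> X"
  using funpow_in_invariant_set[OF T_X z_X] .

lemma orbit_closure_subset_X: "orbit_closure \<subseteq> X"
  unfolding orbit_closure_def using compact_imp_closed[OF compact_X] orbit_in_X
  by (intro closure_minimal) auto

lemma cyl_cong: "r mod n k = s mod n k \<Longrightarrow> cyl k r = cyl k s"
  by (simp add: cyl_def)

lemma orbit_in_cyl: "(T ^^ i) z \<in> cyl k i"
  unfolding cyl_def by (rule subsetD[OF closure_subset]) auto

lemma cyl_subset_orbit_closure: "cyl k r \<subseteq> orbit_closure"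
  unfolding cyl_def orbit_closure_def by (rule closure_mono) auto

text \<open>The bound \<open>near\<close> survives closure because closed balls are closed; the
  closure is taken first in one argument and then in the other.\<close>

lemma dist_cyl:
  assumes "x \<in> cyl k r" "y \<in> cyl k r"
  shows "dist x y \<le> \<eta> k"
proof -
  have "cyl k r \<subseteq> cball ((T ^^ i) z) (\<eta> k)" if "i mod n k = r mod n k" for i
    unfolding cyl_def using that by (intro closure_minimal) (auto intro!: near)
  then have "{(T ^^ i) z | i. i mod n k = r mod n k} \<subseteq> cball x (\<eta> k)"
    using assms(1) by (fastforce simp: dist_commute)
  then have "cyl k r \<subseteq> cball x (\<eta> k)" unfolding cyl_def by (intro closure_minimal) auto
  then show ?thesis using assms(2) by auto
qed

lemma T_cyl: "x \<in> cyl k r \<Longrightarrow> T x \<in> cyl k (Suc r)"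
proof -
  have "T ` cyl k r \<subseteq> cyl k (Suc r)"
  proof (unfold cyl_def[of k r], rule image_closure_subset)
    show "continuous_on (closure {(T ^^ i) z |i. i mod n k = r mod n k}) T"
      using continuous_on_subset[OF cont_T] orbit_closure_subset_X cyl_subset_orbit_closure
      unfolding cyl_def by (meson order_trans)
    show "T ` {(T ^^ i) z |i. i mod n k = r mod n k} \<subseteq> cyl k (Suc r)"
    proof clarify
      fix i assume "i mod n k = r mod n k"
      then have "Suc i mod n k = Suc r mod n k" by (metis mod_Suc_eq)
      then show "T ((T ^^ i) z) \<in> cyl k (Suc r)"
        using orbit_in_cyl[of "Suc i" k] cyl_cong[of "Suc i" k "Suc r"] by simp
    qed
  qed (simp add: cyl_def)
  then show "x \<in> cyl k r \<Longrightarrow> T x \<in> cyl k (Suc r)" by blast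
qed

lemma funpow_cyl: "x \<in> cyl k r \<Longrightarrow> (T ^^ j) x \<in> cyl k (r + j)"
  by (induction j) (auto intro: T_cyl)

text \<open>A residue class modulo \<open>n k\<close> is a finite union of classes modulo
  \<open>n l\<close>, and a finite union of closed sets is closed.\<close>

lemma cyl_refine:
  assumes "k \<le> l" "x \<in> cyl k r"
  obtains a where "a mod n k = r mod n k" "x \<in> cyl l a"
proof -
  have "{(T ^^ i) z | i. i mod n k = r mod n k} \<subseteq> (\<Union>a\<in>{a. a < n l \<and> a mod n k = r mod n k}. cyl l a)"
  proof clarify
    fix i assume "i mod n k = r mod n k"
    moreover have "i mod n l mod n k = i mod n k" by (rule mod_mod_cancel[OF n_dvd[OF assms(1)]])
    moreover have "(T ^^ i) z \<in> cyl l (i mod n l)"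
      using orbit_in_cyl[of i l] cyl_cong[of i l "i mod n l"] by simp
    ultimately show "(T ^^ i) z \<in> (\<Union>a\<in>{a. a < n l \<and> a mod n k = r mod n k}. cyl l a)"
      using n_pos[of l] by (intro UN_I[of "i mod n l"]) auto
  qed
  moreover have "closed (\<Union>a\<in>{a. a < n l \<and> a mod n k = r mod n k}. cyl l a)"
    by (intro closed_UN) (auto simp: cyl_def)
  ultimately have "cyl k r \<subseteq> (\<Union>a\<in>{a. a < n l \<and> a mod n k = r mod n k}. cyl l a)"
    unfolding cyl_def[of k r] by (intro closure_minimal)
  then show ?thesis using that assms(2) by blast
qed

lemma orbit_closure_cyl:
  assumes "x \<in> orbit_closure"
  obtains r where "r < n k" "x \<in> cyl k r"
proof -
  have "range (\<lambda>i. (T ^^ i) z) \<subseteq> (\<Union>r\<in>{..<n k}. cyl k r)"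
  proof clarify
    fix i
    have "(T ^^ i) z \<in> cyl k (i mod n k)"
      using orbit_in_cyl[of i k] cyl_cong[of i k "i mod n k"] by simp
    then show "(T ^^ i) z \<in> (\<Union>r\<in>{..<n k}. cyl k r)" using n_pos[of k] by auto
  qed
  moreover have "closed (\<Union>r\<in>{..<n k}. cyl k r)" by (intro closed_UN) (auto simp: cyl_def)
  ultimately have "orbit_closure \<subseteq> (\<Union>r\<in>{..<n k}. cyl k r)"
    unfolding orbit_closure_def by (intro closure_minimal)
  then show ?thesis using that assms by blast
qed

text \<open>Each \<open>cyl k r\<close> is minimal for the \<open>n k\<close>-th iterate of \<open>T\<close>, so two of them coincide as soon
  as they meet.\<close>

lemma cyl_subset_if_meet:
  assumes "w \<in> cyl k r" "w \<in> cyl k s"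
  shows "cyl k r \<subseteq> cyl k s"
proof -
  have "(T ^^ i) z \<in> cyl k s" if i: "i mod n k = r mod n k" for i
  proof -
    have "\<exists>y\<in>cyl k s. dist y ((T ^^ i) z) < e" if "e > 0" for e
    proof -
      obtain l where l: "l \<ge> k" "\<eta> l < e" using \<eta>_small[OF \<open>e > 0\<close>] .
      obtain a where a: "a mod n k = r mod n k" "w \<in> cyl l a"
        using cyl_refine[OF l(1) assms(1)] .
      \<comment> \<open>Since \<open>a + j = i + n l * a\<close> is congruent to \<open>i\<close>
        modulo \<open>n l\<close>, the \<open>j\<close>-th iterate carries \<open>cyl l a\<close>
        into \<open>cyl l i\<close>. Adding the multiple of \<open>n l\<close> keeps the subtraction
        within the natural numbers.\<close>
      define j where "j = i + n l * a - a"
      have "a \<le> n l * a" using n_pos[of l] by (cases "n l") auto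
      then have aj: "a + j = i + n l * a" unfolding j_def by linarith
      then have "(T ^^ j) w \<in> cyl l i"
        using funpow_cyl[OF a(2), of j] cyl_cong[of "a + j" l i] by simp
      then have "dist ((T ^^ j) w) ((T ^^ i) z) < e"
        using dist_cyl orbit_in_cyl l(2) by (meson le_less_trans)
      \<comment> \<open>Both \<open>a\<close> and \<open>i\<close> are congruent to \<open>r\<close>
        modulo \<open>n k\<close>, so \<open>j\<close> is a multiple of \<open>n k\<close>, and the
        same iterate keeps \<open>w\<close> in \<open>cyl k s\<close>.\<close>
      moreover have "(s + j) mod n k = s mod n k"
      proof -
        have "(a + j) mod n k = i mod n k"
          unfolding aj using n_dvd[OF l(1)] by (metis dvd_mult2 mod_add_right_eq mod_0_imp_dvd dvd_imp_mod_0 add_0_right)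
        then have "(a + j) mod n k = a mod n k" using i a(1) by simp
        then have "n k dvd j" using mod_eq_dvd_iff_nat[of a "a + j" "n k"] by simp
        then show ?thesis by (metis dvd_imp_mod_0 add_0_right mod_add_right_eq)
      qed
      then have "(T ^^ j) w \<in> cyl k s"
        using funpow_cyl[OF assms(2), of j] cyl_cong by blast
      ultimately show ?thesis by blast
    qed
    then have "(T ^^ i) z \<in> closure (cyl k s)" by (simp add: closure_approachable)
    then show ?thesis by (simp add: cyl_def)
  qed
  then show ?thesis unfolding cyl_def[of k r] by (intro closure_minimal) (auto simp: cyl_def)
qed

lemma T_orbit_closure: "T ` orbit_closure \<subseteq> orbit_closure"
proof clarify
  fix x assume "x \<in> orbit_closure"
  then obtain r where "x \<in> cyl 0 r" using orbit_closure_cyl[of x 0] by blast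
  then show "T x \<in> orbit_closure" using T_cyl cyl_subset_orbit_closure by blast
qed

lemma compact_orbit_closure: "compact orbit_closure"
proof -
  have "orbit_closure = X \<inter> orbit_closure" using orbit_closure_subset_X by blast
  then show ?thesis using compact_Int_closed[OF compact_X] by (metis closed_closure orbit_closure_def)
qed

text \<open>Disjoint cylinders of level \<open>k\<close> are a positive distance apart. Points
  closer than that lie in cylinders that meet and hence coincide, and all their iterates share a
  cylinder of diameter at most \<open>\<eta> k\<close>.\<close>

lemma equicontinuous_orbit_closure: "equicontinuous_system orbit_closure T"
  unfolding equicontinuous_system_def
proof (intro allI impI)
  fix e :: real assume "e > 0"
  obtain k where k: "\<eta> k < e" using \<eta>_small[OF \<open>e > 0\<close>, of 0] .
  \<comment> \<open>Cylinders that meet get the default value 1, so that the minimum over all pairs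
    is positive.\<close>
  have "\<exists>d>0. cyl k r \<inter> cyl k s = {} \<longrightarrow> (\<forall>x\<in>cyl k r. \<forall>y\<in>cyl k s. d \<le> dist x y)" for r s
  proof (cases "cyl k r \<inter> cyl k s = {}")
    case True
    have "compact (cyl k r)"
      using compact_Int_closed[OF compact_orbit_closure, of "cyl k r"] cyl_subset_orbit_closure[of k r]
      by (simp add: cyl_def Int_absorb1)
    then show ?thesis using compact_closed_separated[of "cyl k r" "cyl k s"] True
      by (auto simp: cyl_def)
  qed (auto intro: exI[of _ 1])
  then obtain d where d: "\<And>r s. d r s > 0"
      "\<And>r s x y. cyl k r \<inter> cyl k s = {} \<Longrightarrow> x \<in> cyl k r \<Longrightarrow> y \<in> cyl k s \<Longrightarrow> d r s \<le> dist x y"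
    by metis
  define \<delta> where "\<delta> = Min ((\<lambda>(r, s). d r s) ` ({..<n k} \<times> {..<n k}))"
  have "\<delta> > 0" unfolding \<delta>_def using n_pos[of k] d(1) by (subst Min_gr_iff) auto
  moreover have "dist ((T ^^ j) x) ((T ^^ j) y) < e"
    if xy: "x \<in> orbit_closure" "y \<in> orbit_closure" "dist x y < \<delta>" for x y j
  proof -
    obtain r where r: "r < n k" "x \<in> cyl k r" using orbit_closure_cyl[OF xy(1)] .
    obtain s where s: "s < n k" "y \<in> cyl k s" using orbit_closure_cyl[OF xy(2)] .
    have "\<delta> \<le> d r s" unfolding \<delta>_def using r(1) s(1) by (intro Min_le) auto
    then have "cyl k r \<inter> cyl k s \<noteq> {}" using d(2)[OF _ r(2) s(2)] xy(3) by force
    then have "x \<in> cyl k s" using cyl_subset_if_meet r(2) by blast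
    then have "(T ^^ j) x \<in> cyl k (s + j)" "(T ^^ j) y \<in> cyl k (s + j)"
      using s(2) by (auto intro: funpow_cyl)
    then show ?thesis using dist_cyl k by (meson le_less_trans)
  qed
  ultimately show "\<exists>\<delta>>0. \<forall>x\<in>orbit_closure. \<forall>y\<in>orbit_closure. dist x y < \<delta> \<longrightarrow>
      (\<forall>j. dist ((T ^^ j) x) ((T ^^ j) y) < e)"
    by blast
qed

lemma odometer_orbit_closure: "odometer orbit_closure T"
proof -
  have "dynamical_system orbit_closure T"
    using compact_orbit_closure T_orbit_closure continuous_on_subset[OF cont_T orbit_closure_subset_X]
    by (simp add: dynamical_system_def)
  moreover have "regularly_recurrent orbit_closure T z"
    unfolding regularly_recurrent_def
  proof (intro conjI allI impI)
    show "z \<in> orbit_closure" using orbit_in_cyl[of 0 0] cyl_subset_orbit_closure by auto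
    fix U assume U: "openin (top_of_set orbit_closure) U \<and> z \<in> U"
    then obtain e where e: "e > 0" "ball z e \<inter> orbit_closure \<subseteq> U"
      unfolding openin_contains_ball by blast
    obtain k where k: "\<eta> k < e" using \<eta>_small[OF e(1), of 0] .
    have "(T ^^ (n k * j)) z \<in> U" for j
    proof -
      have "dist ((T ^^ 0) z) ((T ^^ (n k * j)) z) \<le> \<eta> k" by (rule near) simp
      moreover have "(T ^^ (n k * j)) z \<in> orbit_closure"
        using orbit_in_cyl cyl_subset_orbit_closure by blast
      ultimately show ?thesis using e(2) k by auto
    qed
    then show "\<exists>k\<ge>1. \<forall>j. (T ^^ (k * j)) z \<in> U"
      using n_pos[of k] by (intro exI[of _ "n k"]) auto
  qed
  ultimately show ?thesis
    using equicontinuous_orbit_closure by (auto simp: odometer_def orbit_closure_def)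
qed

end

section \<open>Regularity and a criterion for ergodicity\<close>

text \<open>The type of \<open>X\<close> need not be a Polish space, so the regularity theorem of the library does not
  apply.\<close>

lemma borel_prob_measure_regular:
  fixes X :: "'a::metric_space set"
  assumes \<mu>: "\<mu> \<in> borel_prob_measures X" and "A \<in> sets borel" "e > 0"
  shows "\<exists>C U. closed C \<and> open U \<and> C \<subseteq> A \<and> A \<subseteq> U \<and> measure \<mu> ((U - C) \<inter> X) < e"
proof -
  interpret prob_space \<mu> using \<mu> by (simp add: borel_prob_measures_def)
  have sets: "B \<inter> X \<in> sets \<mu>" if "B \<in> sets borel" for B
    using \<mu> that by (auto simp: borel_prob_measures_def sets_restrict_space)
  \<comment> \<open>The sets that can be approximated in this way contain the closed sets and are
    stable under complements and countable unions.\<close>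
  have "A \<in> sigma_sets UNIV {S. closed S}"
    using assms(2) by (simp add: borel_eq_closed)
  then show ?thesis
    using \<open>e > 0\<close>
  proof (induction A arbitrary: e rule: sigma_sets.induct)
    case (Basic A)
    then have A: "closed A" by simp
    show ?case
    \<comment> \<open>A nonempty closed set is the intersection of its neighbourhoods
      \<open>U i\<close>, so continuity from above applies. As \<open>infdist x {} = 0\<close>, the
      empty set would get the whole space as each \<open>U i\<close>.\<close>
    proof (cases "A = {}")
      case True
      then show ?thesis using Basic.prems by (intro exI[of _ "{}"]) auto
    next
      case False
      define U where "U i = {x. infdist x A < 1 / Suc i}" for i
      have U_open: "open (U i)" for i
        unfolding U_def by (intro open_Collect_less continuous_intros)
      have "(\<Inter>i. (U i - A) \<inter> X) = {}"
      proof -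
        have "infdist x A = 0" if "\<forall>i. infdist x A < 1 / Suc i" for x
        proof (rule ccontr)
          assume "infdist x A \<noteq> 0"
          then have "infdist x A > 0" using infdist_nonneg[of x A] by simp
          then show False using that reals_Archimedean[of "infdist x A"]
            by (auto simp: inverse_eq_divide not_less[symmetric] intro: less_asym)
        qed
        note zero = this
        show ?thesis
        proof (rule equals0I)
          fix x assume "x \<in> (\<Inter>i. (U i - A) \<inter> X)"
          then have "x \<notin> A" "\<forall>i. infdist x A < 1 / Suc i" by (simp_all add: U_def)
          then show False using zero in_closed_iff_infdist_zero[OF A False] by blast
        qed
      qed
      moreover have "(\<lambda>i. measure \<mu> ((U i - A) \<inter> X)) \<longlonglongrightarrow> measure \<mu> (\<Inter>i. (U i - A) \<inter> X)"
      proof (rule finite_Lim_measure_decseq)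
        show "range (\<lambda>i. (U i - A) \<inter> X) \<subseteq> sets \<mu>" using U_open A by (auto intro!: sets)
        show "decseq (\<lambda>i. (U i - A) \<inter> X)"
        proof -
          have "1 / real (Suc (Suc i)) \<le> 1 / real (Suc i)" for i by (simp add: frac_le)
          then have "U (Suc i) \<subseteq> U i" for i
            unfolding U_def by (intro Collect_mono impI) (erule less_le_trans)
          then show ?thesis unfolding decseq_Suc_iff by blast
        qed
      qed
      ultimately have "(\<lambda>i. measure \<mu> ((U i - A) \<inter> X)) \<longlonglongrightarrow> 0" by simp
      then have "\<forall>\<^sub>F i in sequentially. measure \<mu> ((U i - A) \<inter> X) < e"
        using Basic.prems by (rule order_tendstoD(2))
      then obtain i where "measure \<mu> ((U i - A) \<inter> X) < e" by (auto simp: eventually_sequentially)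
      moreover have "A \<subseteq> U i" by (auto simp: U_def)
      ultimately show ?thesis using A U_open by blast
    qed
  next
    case Empty
    then show ?case by (intro exI[of _ "{}"]) auto
  next
    case (Compl A)
    then obtain C U where "closed C" "open U" "C \<subseteq> A" "A \<subseteq> U" "measure \<mu> ((U - C) \<inter> X) < e" by meson
    moreover have "- C - - U = U - C" by blast
    ultimately show ?case by (intro exI[of _ "- U"] exI[of _ "- C"]) auto
  next
    case (Union A)
    have "\<forall>i. \<exists>C U. closed C \<and> open U \<and> C \<subseteq> A i \<and> A i \<subseteq> U \<and>
        measure \<mu> ((U - C) \<inter> X) < e / 2 * (1 / 2) ^ Suc i"
      using Union.IH \<open>e > 0\<close> by (metis divide_pos_pos mult_pos_pos zero_less_numeral zero_less_one zero_less_power)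
    then obtain C U where CU: "\<And>i. closed (C i)" "\<And>i. open (U i)" "\<And>i. C i \<subseteq> A i" "\<And>i. A i \<subseteq> U i"
        "\<And>i. measure \<mu> ((U i - C i) \<inter> X) < e / 2 * (1 / 2) ^ Suc i"
      by metis
    \<comment> \<open>The union of all \<open>C i\<close> need not be closed, so finite unions are
      used. The errors of the single sets sum to at most \<open>e / 2\<close>, which bounds the
      measure in the limit and leaves room for stopping at a finite \<open>m\<close>.\<close>
    define K where "K m = (\<Union>i\<le>m. C i)" for m
    define V where "V = (\<Union>i. U i)"
    have K: "closed (K m)" for m unfolding K_def using CU(1) by (intro closed_UN) auto
    have V: "open V" unfolding V_def using CU(2) by auto
    have KV: "(V - K m) \<inter> X \<in> sets \<mu>" for m using K V by (auto intro!: sets)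
    have "(\<lambda>m. measure \<mu> ((V - K m) \<inter> X)) \<longlonglongrightarrow> measure \<mu> (\<Inter>m. (V - K m) \<inter> X)"
    proof (rule finite_Lim_measure_decseq)
      show "range (\<lambda>m. (V - K m) \<inter> X) \<subseteq> sets \<mu>" using KV by auto
      show "decseq (\<lambda>m. (V - K m) \<inter> X)"
        unfolding decseq_Suc_iff K_def by (auto simp: atMost_Suc)
    qed
    moreover have "measure \<mu> (\<Inter>m. (V - K m) \<inter> X) \<le> e / 2"
    proof -
      have D: "(U i - C i) \<inter> X \<in> sets \<mu>" for i using CU(1,2) by (auto intro!: sets)
      have sums: "(\<lambda>i. e / 2 * (1 / 2) ^ Suc i) sums (e / 2 * 1)"
        by (intro sums_mult power_half_series)
      have summable: "summable (\<lambda>i. measure \<mu> ((U i - C i) \<inter> X))"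
        by (rule summable_comparison_test'[OF sums_summable[OF sums], of 0])
           (use CU(5) in \<open>auto intro: less_imp_le\<close>)
      have "(\<Inter>m. (V - K m) \<inter> X) \<subseteq> (\<Union>i. (U i - C i) \<inter> X)"
        by (auto simp: V_def K_def)
      moreover have "(\<Union>i. (U i - C i) \<inter> X) \<in> sets \<mu>" using D by (intro sets.countable_UN) auto
      ultimately have "measure \<mu> (\<Inter>m. (V - K m) \<inter> X) \<le> measure \<mu> (\<Union>i. (U i - C i) \<inter> X)"
        by (rule finite_measure_mono)
      also have "\<dots> \<le> (\<Sum>i. measure \<mu> ((U i - C i) \<inter> X))"
        using D summable by (intro finite_measure_subadditive_countably) auto
      also have "\<dots> \<le> (\<Sum>i. e / 2 * (1 / 2) ^ Suc i)"
        using CU(5) by (intro suminf_le summable sums_summable[OF sums]) (auto intro: less_imp_le)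
      also have "\<dots> = e / 2" using sums_unique[OF sums] by simp
      finally show ?thesis .
    qed
    moreover from this have "measure \<mu> (\<Inter>m. (V - K m) \<inter> X) < e" using \<open>e > 0\<close> by linarith
    ultimately have "\<forall>\<^sub>F m in sequentially. measure \<mu> ((V - K m) \<inter> X) < e"
      by (intro order_tendstoD(2))
    then obtain m where "measure \<mu> ((V - K m) \<inter> X) < e" by (auto simp: eventually_sequentially)
    moreover have "K m \<subseteq> (\<Union>i. A i)" "(\<Union>i. A i) \<subseteq> V"
      using CU(3,4) unfolding K_def V_def by blast+
    ultimately show ?case using K V by (intro exI[of _ "K m"] exI[of _ V] conjI)
  qed
qed

text \<open>\<open>f\<close> agrees with the indicator on \<open>C\<close> and off \<open>U\<close>,
  and in between the two differ by at most 1.\<close>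

lemma integral_abs_diff_indicator_le:
  fixes f :: "'a::metric_space \<Rightarrow> real"
  assumes \<mu>: "\<mu> \<in> borel_prob_measures X" and "closed C" "open U" "C \<subseteq> B" "B \<subseteq> U"
    and B: "B \<in> sets borel" and f: "continuous_on X f" "\<And>x. x \<in> X \<Longrightarrow> 0 \<le> f x \<and> f x \<le> 1"
    and fC: "\<And>x. x \<in> X \<inter> C \<Longrightarrow> f x = 1" and fU: "\<And>x. x \<in> X - U \<Longrightarrow> f x = 0"
  shows "(\<integral>x. \<bar>f x - indicator (B \<inter> X) x\<bar> \<partial>\<mu>) \<le> measure \<mu> ((U - C) \<inter> X)"
proof -
  interpret prob_space \<mu> using \<mu> by (simp add: borel_prob_measures_def)
  have sets: "B \<inter> X \<in> sets \<mu>" if "B \<in> sets borel" for B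
    using \<mu> that by (auto simp: borel_prob_measures_def sets_restrict_space)
  have UC: "(U - C) \<inter> X \<in> sets \<mu>" using assms by (intro sets) auto
  have [measurable]: "f \<in> borel_measurable \<mu>"
    by (rule borel_measurable_continuous_on_carrier[OF \<mu> f(1)])
  have [measurable]: "B \<inter> X \<in> sets \<mu>" by (rule sets[OF B])
  have bound: "\<bar>f x - indicator (B \<inter> X) x\<bar> \<le> indicator ((U - C) \<inter> X) x" if "x \<in> space \<mu>" for x
    using that fC fU f(2)[of x] \<open>C \<subseteq> B\<close> \<open>B \<subseteq> U\<close> space_borel_prob_measures[OF \<mu>]
    by (fastforce simp: indicator_def)
  have "(\<integral>x. \<bar>f x - indicator (B \<inter> X) x\<bar> \<partial>\<mu>) \<le> (\<integral>x. indicator ((U - C) \<inter> X) x \<partial>\<mu>)"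
  proof (rule integral_mono)
    show "integrable \<mu> (\<lambda>x. \<bar>f x - indicator (B \<inter> X) x\<bar>)"
    proof (rule integrable_const_bound[of _ 1])
      show "AE x in \<mu>. norm \<bar>f x - indicator (B \<inter> X) x\<bar> \<le> 1"
        using order_trans[OF bound indicator_le_1] by (intro AE_I2) simp
    qed measurable
  qed (use bound UC in \<open>auto simp: emeasure_eq_measure\<close>)
  then show ?thesis using UC by (simp add: sets.Int_space_eq2)
qed

section \<open>Continuous functions determine Borel probability measures\<close>

lemma closed_open_Urysohn:
  fixes C U :: "'a::metric_space set"
  assumes "closed C" "open U" "C \<subseteq> U"
  obtains f :: "'a \<Rightarrow> real" where "continuous_on UNIV f" "\<And>x. 0 \<le> f x \<and> f x \<le> 1"
    "\<And>x. x \<in> C \<Longrightarrow> f x = 1" "\<And>x. x \<notin> U \<Longrightarrow> f x = 0"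
\<comment> \<open>The quotient of distances below would be wrong here, since the distance to the
  empty set is 0; constants do instead.\<close>
proof (cases "C = {} \<or> U = UNIV")
  case True
  then show ?thesis using that[of "\<lambda>_. 0"] that[of "\<lambda>_. 1"] by auto
next
  case False
  define f where "f x = infdist x (- U) / (infdist x (- U) + infdist x C)" for x
  have pos: "infdist x (- U) + infdist x C > 0" for x
  proof -
    have "infdist x (- U) \<noteq> 0 \<or> infdist x C \<noteq> 0"
      using in_closed_iff_infdist_zero[OF assms(1)] in_closed_iff_infdist_zero[of "- U" x]
        assms False by (metis ComplD Compl_UNIV_eq closed_Compl double_complement subsetD)
    then show ?thesis using infdist_nonneg[of x "- U"] infdist_nonneg[of x C] by linarith
  qed
  show ?thesis
  proof (rule that[of f])
    show "continuous_on UNIV f" unfolding f_def using pos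
      by (intro continuous_intros) (auto simp: less_imp_neq[THEN not_sym])
    show "0 \<le> f x \<and> f x \<le> 1" for x
      using pos[of x] infdist_nonneg[of x "- U"] infdist_nonneg[of x C]
      by (simp add: f_def divide_le_eq)
    show "f x = 1" if "x \<in> C" for x
      using pos[of x] that by (simp add: f_def)
    show "f x = 0" if "x \<notin> U" for x
      using that by (simp add: f_def)
  qed
qed

lemma abs_measure_diff_integral_le:
  fixes f :: "'a::metric_space \<Rightarrow> real"
  assumes "\<mu> \<in> borel_prob_measures X" "compact X" "continuous_on X f" "A \<in> sets \<mu>"
  shows "\<bar>(\<integral>x. f x \<partial>\<mu>) - measure \<mu> A\<bar> \<le> (\<integral>x. \<bar>f x - indicator A x\<bar> \<partial>\<mu>)"
proof -
  interpret prob_space \<mu> using assms(1) by (simp add: borel_prob_measures_def)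
  have "(\<integral>x. f x \<partial>\<mu>) - measure \<mu> A = (\<integral>x. f x - indicator A x \<partial>\<mu>)"
    using integrable_continuous_on_carrier[OF assms(1-3)] assms(4)
    by (subst Bochner_Integration.integral_diff) (auto simp: emeasure_eq_measure sets.Int_space_eq2)
  then show ?thesis by (simp add: integral_abs_bound)
qed

text \<open>Regularity and Urysohn functions transfer equality from integrals to sets. This turns
  invariance tested on continuous functions into invariance on Borel sets.\<close>

lemma borel_prob_measures_eqI:
  fixes X :: "'a::metric_space set"
  assumes \<mu>: "\<mu> \<in> borel_prob_measures X" and \<nu>: "\<nu> \<in> borel_prob_measures X" and X: "compact X"
    and eq: "\<And>f. continuous_on X f \<Longrightarrow> (\<integral>x. f x \<partial>\<mu>) = (\<integral>x. (f x :: real) \<partial>\<nu>)"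
    and "A \<in> sets \<mu>"
  shows "measure \<mu> A = measure \<nu> A"
proof -
  obtain B where B: "B \<in> sets borel" "A = B \<inter> X"
    using assms(5) \<mu> by (auto simp: borel_prob_measures_def sets_restrict_space)
  have A: "A \<in> sets \<mu>" "A \<in> sets \<nu>" using \<mu> \<nu> assms(5) by (auto simp: borel_prob_measures_def)
  have sets: "B \<inter> X \<in> sets \<rho>" if "B \<in> sets borel" "\<rho> \<in> borel_prob_measures X" for B \<rho>
    using that by (auto simp: borel_prob_measures_def sets_restrict_space)
  have "\<bar>measure \<mu> A - measure \<nu> A\<bar> \<le> e" if "e > 0" for e
  proof -
    have "e / 2 > 0" using that by simp
    obtain C U where CU: "closed C" "open U" "C \<subseteq> B" "B \<subseteq> U" "measure \<mu> ((U - C) \<inter> X) < e / 2"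
      using borel_prob_measure_regular[OF \<mu> B(1) \<open>e / 2 > 0\<close>] by blast
    obtain C' U' where CU': "closed C'" "open U'" "C' \<subseteq> B" "B \<subseteq> U'" "measure \<nu> ((U' - C') \<inter> X) < e / 2"
      using borel_prob_measure_regular[OF \<nu> B(1) \<open>e / 2 > 0\<close>] by blast
    \<comment> \<open>One function has to approximate the indicator for both measures at once, hence
      the larger closed and the smaller open set.\<close>
    define K where "K = C \<union> C'"
    define V where "V = U \<inter> U'"
    have KV: "closed K" "open V" "K \<subseteq> B" "B \<subseteq> V" using CU CU' by (auto simp: K_def V_def)
    obtain f :: "'a \<Rightarrow> real" where f: "continuous_on UNIV f" "\<And>x. 0 \<le> f x \<and> f x \<le> 1"
        "\<And>x. x \<in> K \<Longrightarrow> f x = 1" "\<And>x. x \<notin> V \<Longrightarrow> f x = 0"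
      using closed_open_Urysohn[OF KV(1,2)] KV(3,4) by (metis order_trans)
    have f_cont: "continuous_on X f" using f(1) continuous_on_subset by blast
    have close: "\<bar>(\<integral>x. f x \<partial>\<rho>) - measure \<rho> A\<bar> \<le> measure \<rho> ((V - K) \<inter> X)"
      if "\<rho> \<in> borel_prob_measures X" "A \<in> sets \<rho>" for \<rho>
      using abs_measure_diff_integral_le[OF that(1) X f_cont that(2)]
        integral_abs_diff_indicator_le[OF that(1) KV B(1) f_cont] f by (fastforce simp: B(2))
    have "measure \<mu> ((V - K) \<inter> X) \<le> measure \<mu> ((U - C) \<inter> X)"
      using \<mu> CU by (intro finite_measure.finite_measure_mono sets)
        (auto simp: K_def V_def borel_prob_measures_def prob_space_def)
    moreover have "measure \<nu> ((V - K) \<inter> X) \<le> measure \<nu> ((U' - C') \<inter> X)"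
      using \<nu> CU' by (intro finite_measure.finite_measure_mono sets)
        (auto simp: K_def V_def borel_prob_measures_def prob_space_def)
    ultimately show ?thesis
      using close[OF \<mu> A(1)] close[OF \<nu> A(2)] eq[OF f_cont] CU(5) CU'(5) by linarith
  qed
  then have "\<bar>measure \<mu> A - measure \<nu> A\<bar> \<le> 0" by (rule field_le_epsilon[of _ 0, simplified])
  then show ?thesis by simp
qed

text \<open>For \<open>N = 0\<close> the value is 0 and a variance formula with it would be at most
  0; this is why the variance conditions below ask for \<open>N > 0\<close>.\<close>

definition birkhoff_avg :: "('a \<Rightarrow> 'a) \<Rightarrow> nat \<Rightarrow> ('a \<Rightarrow> real) \<Rightarrow> 'a \<Rightarrow> real" where
  "birkhoff_avg T N f x = (\<Sum>i<N. f ((T ^^ i) x)) / N"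

lemma continuous_on_birkhoff_avg:
  fixes T :: "'a::metric_space \<Rightarrow> 'a"
  assumes "continuous_on X T" "T ` X \<subseteq> X" "continuous_on X f"
  shows "continuous_on X (birkhoff_avg T N f)"
proof (cases "N = 0")
  case False
  have "continuous_on X (\<lambda>x. f ((T ^^ i) x))" for i
    by (rule continuous_on_compose2[OF assms(3) continuous_on_funpow[OF assms(1,2)]])
       (use funpow_in_invariant_set[OF assms(2)] in auto)
  then show ?thesis unfolding birkhoff_avg_def using False by (intro continuous_intros) auto
qed (simp add: birkhoff_avg_def)

text \<open>With \<open>S\<close> ranging over the finite subsets of a countable dense set, this is the countable family
  of test functions. The empty set is treated apart because \<open>infdist x {} = 0\<close>.\<close>

definition bump :: "'a::metric_space set \<Rightarrow> nat \<Rightarrow> 'a \<Rightarrow> real" where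
  "bump S m x = (if S = {} then 0 else max 0 (min 1 (2 - m * infdist x S)))"

lemma bump_bounds: "0 \<le> bump S m x" "bump S m x \<le> 1"
  by (auto simp: bump_def)

lemma continuous_on_bump: "continuous_on A (bump S m)"
proof (cases "S = {}")
  case False
  have "continuous_on A (\<lambda>x. max 0 (min 1 (2 - m * infdist x S)))"
    by (intro continuous_intros)
  then show ?thesis using False by (simp add: bump_def)
qed (simp add: bump_def)

text \<open>A bump is 1 up to distance \<open>1 / m\<close> from \<open>S\<close> and 0 from
  \<open>2 / m\<close> on. With \<open>r = 1 / Suc m\<close> below a third of the gap \<delta>
  between \<open>X \<inter> C\<close> and the complement of \<open>U\<close>, moving an
  \<open>r / 2\<close>-net of \<open>X \<inter> C\<close> into \<open>D\<close> keeps
  \<open>X \<inter> C\<close> within \<open>r\<close> of the net and the complement of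
  \<open>U\<close> at least \<open>2 * r\<close> away.\<close>

lemma bump_separates:
  fixes X C U D :: "'a::metric_space set"
  assumes X: "compact X" and "closed C" "open U" "C \<subseteq> U" and D: "X \<subseteq> closure D"
  obtains S m where "finite S" "S \<subseteq> D" "\<And>x. x \<in> X \<inter> C \<Longrightarrow> bump S m x = 1"
    "\<And>x. x \<in> X - U \<Longrightarrow> bump S m x = 0"
proof -
  define K where "K = X \<inter> C"
  have K: "compact K" "K \<inter> - U = {}" using assms compact_Int_closed by (auto simp: K_def)
  obtain \<delta> where \<delta>: "\<delta> > 0" "\<And>x y. x \<in> K \<Longrightarrow> y \<notin> U \<Longrightarrow> \<delta> \<le> dist x y"
    using compact_closed_separated[OF K(1) closed_Compl[OF \<open>open U\<close>] K(2)] by auto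
  obtain m where m: "inverse (real (Suc m)) < \<delta> / 3" using reals_Archimedean[of "\<delta> / 3"] \<delta>(1) by auto
  define r where "r = inverse (real (Suc m))"
  have r: "r > 0" "r < \<delta> / 3" using m by (auto simp: r_def)
  have "r / 2 > 0" using r(1) by simp
  then obtain P where P: "finite P" "P \<subseteq> K" "K \<subseteq> (\<Union>c\<in>P. ball c (r / 2))"
    using seq_compact_imp_totally_bounded[OF compact_imp_seq_compact[OF K(1)]] by meson
  have "\<exists>d\<in>D. dist d c < r / 2" if "c \<in> P" for c
  proof -
    have "c \<in> closure D" using that P(2) D by (auto simp: K_def)
    then show ?thesis using \<open>r / 2 > 0\<close> unfolding closure_approachable by blast
  qed
  then obtain d where d: "\<And>c. c \<in> P \<Longrightarrow> d c \<in> D" "\<And>c. c \<in> P \<Longrightarrow> dist (d c) c < r / 2" by metis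
  show ?thesis
  proof (rule that[of "d ` P" "Suc m"])
    show "bump (d ` P) (Suc m) x = 1" if x: "x \<in> X \<inter> C" for x
    proof -
      obtain c where c: "c \<in> P" "dist c x < r / 2" using P(3) x by (auto simp: K_def)
      have "infdist x (d ` P) \<le> dist x (d c)" using c(1) by (intro infdist_le) auto
      also have "\<dots> \<le> r"
        using c d(2)[OF c(1)] dist_triangle[of x "d c" c] by (simp add: dist_commute)
      finally have "Suc m * infdist x (d ` P) \<le> Suc m * r" by (intro mult_left_mono) auto
      also have "\<dots> = 1" by (simp add: r_def)
      finally show ?thesis using c(1) by (auto simp: bump_def)
    qed
    show "bump (d ` P) (Suc m) x = 0" if x: "x \<in> X - U" for x
    proof (cases "P = {}")
      case False
      have "2 * r \<le> dist x (d c)" if c: "c \<in> P" for c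
      proof -
        have "c \<in> K" "x \<notin> U" using c P(2) x by auto
        then have "\<delta> \<le> dist c x" by (rule \<delta>(2))
        then show ?thesis using d(2)[OF c] dist_triangle[of c x "d c"] r by (simp add: dist_commute)
      qed
      then have "2 * r \<le> infdist x (d ` P)"
        using False by (auto simp: infdist_notempty intro!: cINF_greatest)
      then have "Suc m * (2 * r) \<le> Suc m * infdist x (d ` P)" by (intro mult_left_mono) auto
      also have "Suc m * (2 * r) = 2" by (simp add: r_def)
      finally have "2 \<le> Suc m * infdist x (d ` P)" .
      then show ?thesis by (simp add: bump_def del: of_nat_Suc)
    qed (simp add: bump_def)
  qed (use P(1) d(1) in auto)
qed

text \<open>If the variances of the Birkhoff averages of \<open>f\<close> are arbitrarily small for \<open>L\<^sup>1\<close>-densely many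
  \<open>f\<close>, then the indicator of an invariant set, being its own Birkhoff average, has zero variance.\<close>

lemma ergodic_if_variances_small:
  fixes X :: "'a::metric_space set" and T :: "'a \<Rightarrow> 'a"
  assumes sys: "dynamical_system X T" and \<mu>: "\<mu> \<in> invariant_measures X T" and D: "X \<subseteq> closure D"
    and var: "\<And>S m e. finite S \<Longrightarrow> S \<subseteq> D \<Longrightarrow> e > 0 \<Longrightarrow>
      \<exists>N>0. (\<integral>x. (birkhoff_avg T N (bump S m) x)\<^sup>2 \<partial>\<mu>) - (\<integral>x. bump S m x \<partial>\<mu>)\<^sup>2 < e"
  shows "\<mu> \<in> ergodic_measures X T"
proof -
  have X: "compact X" "continuous_on X T" "T ` X \<subseteq> X" using sys by (auto simp: dynamical_system_def)
  have \<mu>': "\<mu> \<in> borel_prob_measures X" using \<mu> by (simp add: invariant_measures_def)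
  then interpret prob_space \<mu> by (simp add: borel_prob_measures_def)
  have space: "space \<mu> = X" by (rule space_borel_prob_measures[OF \<mu>'])
  have "prob A = 0 \<or> prob A = 1" if A: "A \<in> sets \<mu>" and inv: "T -` A \<inter> X = A" for A
  proof -
    define a where "a = prob A"
    have a: "0 \<le> a" "a \<le> 1" by (auto simp: a_def)
    obtain B where B: "B \<in> sets borel" "A = B \<inter> X"
      using A \<mu>' by (auto simp: borel_prob_measures_def sets_restrict_space)
    \<comment> \<open>\<open>a - a\<^sup>2\<close> is the variance of the indicator of
      \<open>A\<close>, and it vanishes only for \<open>a = 0\<close> and
      \<open>a = 1\<close>.\<close>
    have "a - a\<^sup>2 \<le> e" if "e > 0" for e
    proof -
      \<comment> \<open>The variance is split into three parts, each of size at most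
        \<open>e'\<close> and each with a factor 3. The bound \<open>e' \<le> 1\<close> serves to
        estimate \<open>(c - a)\<^sup>2\<close> by \<open>e'\<close>.\<close>
      define e' where "e' = min 1 (e / 9)"
      have e': "0 < e'" "e' \<le> 1" "9 * e' \<le> e" using that by (auto simp: e'_def)
      obtain C U where CU: "closed C" "open U" "C \<subseteq> B" "B \<subseteq> U" "prob ((U - C) \<inter> X) < e'"
        using borel_prob_measure_regular[OF \<mu>' B(1) e'(1)] by blast
      have "C \<subseteq> U" using CU by blast
      obtain S m where S: "finite S" "S \<subseteq> D" "\<And>x. x \<in> X \<inter> C \<Longrightarrow> bump S m x = 1"
          "\<And>x. x \<in> X - U \<Longrightarrow> bump S m x = 0"
        using bump_separates[OF X(1) CU(1,2) \<open>C \<subseteq> U\<close> D] by blast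
      define f where "f = bump S m"
      have f: "0 \<le> f x" "f x \<le> 1" for x using bump_bounds by (auto simp: f_def)
      have f_cont: "continuous_on X f" unfolding f_def by (rule continuous_on_bump)
      have [measurable]: "f \<in> borel_measurable \<mu>"
        by (rule borel_measurable_continuous_on_carrier[OF \<mu>' f_cont])
      have [measurable]: "A \<in> sets \<mu>" by (rule A)
      have [measurable]: "T \<in> measurable \<mu> \<mu>" by (rule measurable_self_map[OF \<mu>' X(2,3)])
      define E where "E = (\<integral>x. \<bar>f x - indicator A x\<bar> \<partial>\<mu>)"
      have "E \<le> prob ((U - C) \<inter> X)"
        unfolding E_def B(2) using f S(3,4)
        by (intro integral_abs_diff_indicator_le[OF \<mu>' CU(1-4) B(1) f_cont]) (auto simp: f_def)
      then have E: "E \<le> e'" using CU(5) by simp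
      obtain N where N: "N > 0" "(\<integral>x. (birkhoff_avg T N f x)\<^sup>2 \<partial>\<mu>) - (\<integral>x. f x \<partial>\<mu>)\<^sup>2 < e'"
        using var[OF S(1,2) e'(1)] unfolding f_def by blast
      define g where "g = birkhoff_avg T N f"
      define c where "c = (\<integral>x. f x \<partial>\<mu>)"
      have g_cont: "continuous_on X g"
        unfolding g_def by (rule continuous_on_birkhoff_avg[OF X(2,3) f_cont])
      have g_int: "integrable \<mu> g" by (rule integrable_continuous_on_carrier[OF \<mu>' X(1) g_cont])
      have g2_int: "integrable \<mu> (\<lambda>x. (g x)\<^sup>2)"
        by (intro integrable_continuous_on_carrier[OF \<mu>' X(1)] continuous_on_power g_cont)
      have [measurable]: "g \<in> borel_measurable \<mu>"
        by (rule borel_measurable_continuous_on_carrier[OF \<mu>' g_cont])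
      have g: "0 \<le> g x" "g x \<le> 1" for x
      proof -
        show "0 \<le> g x" using f by (simp add: g_def birkhoff_avg_def sum_nonneg)
        have "(\<Sum>i<N. f ((T ^^ i) x)) \<le> (\<Sum>i<N. 1)" using f by (intro sum_mono) auto
        then show "g x \<le> 1" using N(1) by (simp add: g_def birkhoff_avg_def divide_le_eq)
      qed
      have f_iter_int: "integrable \<mu> (\<lambda>x. f ((T ^^ i) x))" for i
        by (rule integrable_continuous_on_carrier[OF \<mu>' X(1)],
            rule continuous_on_compose2[OF f_cont continuous_on_funpow[OF X(2,3)]])
           (use funpow_in_invariant_set[OF X(3)] in auto)
      have g_mean: "(\<integral>x. g x \<partial>\<mu>) = c"
        using N(1) f_iter_int
        by (simp add: g_def birkhoff_avg_def c_def integral_invariant_funpow[OF \<mu> X(2,3)])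
      have dev_int: "integrable \<mu> (\<lambda>x. \<bar>f ((T ^^ i) x) - indicator A ((T ^^ i) x)\<bar>)" for i
      proof (rule integrable_const_bound[of _ 1])
        show "AE x in \<mu>. norm \<bar>f ((T ^^ i) x) - indicator A ((T ^^ i) x)\<bar> \<le> 1"
        proof -
          have "\<bar>f y - indicator A y\<bar> \<le> 1" for y
            using f[of y] by (simp add: indicator_def abs_le_iff)
          then show ?thesis by simp
        qed
        have [measurable]: "(T ^^ i) \<in> measurable \<mu> \<mu>"
          by (rule measurable_self_map[OF \<mu>' continuous_on_funpow[OF X(2,3)]])
             (use funpow_in_invariant_set[OF X(3)] in auto)
        show "(\<lambda>x. \<bar>f ((T ^^ i) x) - indicator A ((T ^^ i) x)\<bar>) \<in> borel_measurable \<mu>" by measurable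
      qed
      have ind_iter: "indicator A ((T ^^ i) x) = (indicator A x :: real)" if "x \<in> X" for i x
      proof -
        have "(T ^^ i) x \<in> A \<longleftrightarrow> x \<in> A"
        proof (induction i)
          case (Suc i)
          have "(T ^^ Suc i) x \<in> A \<longleftrightarrow> (T ^^ i) x \<in> T -` A \<inter> X"
            using funpow_in_invariant_set[OF X(3) that] by simp
          then show ?case using Suc by (simp only: inv)
        qed simp
        then show ?thesis by (simp add: indicator_def)
      qed
      have d_int: "integrable \<mu> (\<lambda>x. \<bar>g x - indicator A x\<bar>)"
        using g_int A by (auto intro!: integrable_abs Bochner_Integration.integrable_diff
            integrable_real_indicator simp: emeasure_eq_measure)
      \<comment> \<open>By invariance of \<mu> all \<open>N\<close> terms have the same integral
        \<open>E\<close>, so averaging does not increase the mean distance to the invariant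
        indicator.\<close>
      have "(\<integral>x. \<bar>g x - indicator A x\<bar> \<partial>\<mu>)
          \<le> (\<integral>x. (\<Sum>i<N. \<bar>f ((T ^^ i) x) - indicator A ((T ^^ i) x)\<bar>) / N \<partial>\<mu>)"
      proof (rule integral_mono)
        fix x assume x: "x \<in> space \<mu>"
        have "g x - indicator A x = (\<Sum>i<N. f ((T ^^ i) x) - indicator A ((T ^^ i) x)) / N"
          using N(1) x by (simp add: g_def birkhoff_avg_def sum_subtractf ind_iter space field_simps)
        then have "\<bar>g x - indicator A x\<bar> = \<bar>\<Sum>i<N. f ((T ^^ i) x) - indicator A ((T ^^ i) x)\<bar> / N"
          by (simp add: abs_divide)
        also have "\<dots> \<le> (\<Sum>i<N. \<bar>f ((T ^^ i) x) - indicator A ((T ^^ i) x)\<bar>) / N"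
          by (intro divide_right_mono sum_abs) simp
        finally show "\<bar>g x - indicator A x\<bar> \<le> (\<Sum>i<N. \<bar>f ((T ^^ i) x) - indicator A ((T ^^ i) x)\<bar>) / N" .
      qed (use d_int dev_int in auto)
      also have "\<dots> = (\<Sum>i<N. (\<integral>x. \<bar>f ((T ^^ i) x) - indicator A ((T ^^ i) x)\<bar> \<partial>\<mu>)) / N"
        using dev_int by simp
      also have "\<dots> = (\<Sum>i<N. E) / N"
      proof -
        have "(\<integral>x. \<bar>f ((T ^^ i) x) - indicator A ((T ^^ i) x)\<bar> \<partial>\<mu>) = E" for i
          unfolding E_def
          by (rule integral_invariant_funpow[OF \<mu> X(2,3), of "\<lambda>x. \<bar>f x - indicator A x\<bar>"]) measurable
        then show ?thesis by simp
      qed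
      also have "\<dots> = E" using N(1) by simp
      finally have dev: "(\<integral>x. \<bar>g x - indicator A x\<bar> \<partial>\<mu>) \<le> e'" using E by simp
      have "a - a\<^sup>2 = (\<integral>x. (indicator A x - a)\<^sup>2 \<partial>\<mu>)"
      proof -
        have "(\<integral>x. (indicator A x - a)\<^sup>2 \<partial>\<mu>) = (\<integral>x. (1 - 2 * a) * indicator A x + a\<^sup>2 \<partial>\<mu>)"
          by (intro Bochner_Integration.integral_cong)
             (auto simp: indicator_def power2_eq_square algebra_simps)
        also have "\<dots> = (1 - 2 * a) * a + a\<^sup>2"
          using A by (subst Bochner_Integration.integral_add)
            (auto simp: a_def prob_space emeasure_eq_measure sets.Int_space_eq2)
        finally show ?thesis by (simp add: power2_eq_square algebra_simps)
      qed
      also have "\<dots> \<le> (\<integral>x. 3 * \<bar>g x - indicator A x\<bar> + (3 * (g x - c)\<^sup>2 + 3 * (c - a)\<^sup>2) \<partial>\<mu>)"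
      proof (rule integral_mono)
        fix x assume "x \<in> space \<mu>"
        \<comment> \<open>The deviation of the indicator from \<open>g\<close>, of \<open>g\<close>
          from its mean \<open>c\<close>, and of \<open>c\<close> from \<open>a\<close>. Only the
          mean of \<open>\<bar>u\<bar>\<close> is controlled, which suffices because
          \<open>\<bar>u\<bar> \<le> 1\<close>.\<close>
        define u v w where "u = indicator A x - g x" and "v = g x - c" and "w = c - a"
        have "(indicator A x - a)\<^sup>2 = (u + v + w)\<^sup>2" by (simp add: u_def v_def w_def)
        also have "\<dots> \<le> 3 * u\<^sup>2 + 3 * v\<^sup>2 + 3 * w\<^sup>2"
        proof -
          have "0 \<le> (u - v)\<^sup>2 + (v - w)\<^sup>2 + (u - w)\<^sup>2" by simp
          then show ?thesis by (simp add: power2_eq_square algebra_simps)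
        qed
        also have "u\<^sup>2 \<le> \<bar>u\<bar>"
        proof -
          have "\<bar>u\<bar> \<le> 1" using g[of x] by (auto simp: u_def indicator_def)
          then have "\<bar>u\<bar> * \<bar>u\<bar> \<le> \<bar>u\<bar> * 1" by (intro mult_left_mono) auto
          then show ?thesis by (simp add: power2_eq_square)
        qed
        finally show "(indicator A x - a)\<^sup>2 \<le> 3 * \<bar>g x - indicator A x\<bar> + (3 * (g x - c)\<^sup>2 + 3 * (c - a)\<^sup>2)"
          by (simp add: u_def v_def w_def abs_minus_commute)
      next
        show "integrable \<mu> (\<lambda>x. (indicator A x - a)\<^sup>2)"
        proof (rule integrable_const_bound[of _ 1])
          show "AE x in \<mu>. norm ((indicator A x - a)\<^sup>2) \<le> 1"
            using a by (intro AE_I2) (auto simp: indicator_def abs_square_le_1)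
        qed measurable
        have "integrable \<mu> (\<lambda>x. (g x - c)\<^sup>2)"
          using g_cont by (intro integrable_continuous_on_carrier[OF \<mu>' X(1)] continuous_intros)
        then show "integrable \<mu> (\<lambda>x. 3 * \<bar>g x - indicator A x\<bar> + (3 * (g x - c)\<^sup>2 + 3 * (c - a)\<^sup>2))"
          using d_int by simp
      qed
      also have "\<dots> = 3 * (\<integral>x. \<bar>g x - indicator A x\<bar> \<partial>\<mu>) + (3 * ((\<integral>x. (g x)\<^sup>2 \<partial>\<mu>) - c\<^sup>2) + 3 * (c - a)\<^sup>2)"
      proof -
        have "(\<integral>x. (g x - c)\<^sup>2 \<partial>\<mu>) = (\<integral>x. (g x)\<^sup>2 + (c\<^sup>2 - 2 * c * g x) \<partial>\<mu>)"
          by (simp add: power2_diff algebra_simps)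
        also have "\<dots> = (\<integral>x. (g x)\<^sup>2 \<partial>\<mu>) + (c\<^sup>2 - 2 * c * c)"
          using g2_int g_int by (simp add: g_mean prob_space)
        finally have "(\<integral>x. (g x - c)\<^sup>2 \<partial>\<mu>) = (\<integral>x. (g x)\<^sup>2 \<partial>\<mu>) - c\<^sup>2"
          by (simp add: power2_eq_square)
        moreover have "integrable \<mu> (\<lambda>x. (g x - c)\<^sup>2)"
          using g_cont by (intro integrable_continuous_on_carrier[OF \<mu>' X(1)] continuous_intros)
        ultimately show ?thesis using d_int by (simp add: prob_space)
      qed
      also have "\<dots> \<le> 3 * e' + (3 * e' + 3 * e')"
      proof -
        have "\<bar>c - a\<bar> \<le> E"
          unfolding c_def a_def E_def by (rule abs_measure_diff_integral_le[OF \<mu>' X(1) f_cont A])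
        then have "\<bar>c - a\<bar> * \<bar>c - a\<bar> \<le> e' * 1" using E e' by (intro mult_mono) auto
        then have "(c - a)\<^sup>2 \<le> e'" by (simp add: power2_eq_square)
        moreover have "(\<integral>x. (g x)\<^sup>2 \<partial>\<mu>) - c\<^sup>2 \<le> e'" using N(2) by (simp add: c_def g_def)
        ultimately show ?thesis using dev by (intro add_mono mult_left_mono) auto
      qed
      finally show ?thesis using e'(3) by linarith
    qed
    then have "a - a\<^sup>2 \<le> 0" by (rule field_le_epsilon[of _ 0, simplified])
    moreover have "a\<^sup>2 \<le> a" using a by (simp add: power2_eq_square mult_left_le)
    ultimately have "a * (1 - a) = 0" by (simp add: power2_eq_square algebra_simps)
    then show ?thesis by (simp add: a_def)
  qed
  then show ?thesis using \<mu> by (simp add: ergodic_measures_def)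
qed

section \<open>The invariant measure of an odometer\<close>

context nested_almost_periods
begin

text \<open>The invariant measure is the image of Lebesgue measure on \<open>[0,1)\<close>: the digits of \<open>u\<close> in the
  mixed radix system with radices \<open>n (Suc k) div n k\<close>, read in reverse order by \<open>residue k\<close>, form a compatible
  sequence of uniformly distributed residues modulo \<open>n k\<close>.\<close>

primrec residue :: "nat \<Rightarrow> nat \<Rightarrow> nat" where
  "residue 0 b = b"
| "residue (Suc k) b =
     residue k (b div (n (Suc k) div n k)) + n k * (b mod (n (Suc k) div n k))"

definition digit_time :: "nat \<Rightarrow> real \<Rightarrow> nat" where
  "digit_time k u = residue k (nat \<lfloor>real (n k) * u\<rfloor>)"

definition coding :: "real \<Rightarrow> 'a" where
  "coding u = lim (\<lambda>k. (T ^^ digit_time k u) z)"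

abbreviation unit_interval :: "real measure" where
  "unit_interval \<equiv> restrict_space lborel {0..<1}"

text \<open>The target is all of \<open>X\<close> and not \<open>orbit_closure\<close>, so that the
  result is a member of \<open>borel_prob_measures X\<close>.\<close>

definition odometer_measure :: "'a measure" where
  "odometer_measure = distr unit_interval (restrict_space borel X) coding"

lemma n_Suc_eq: "n (Suc k) = n k * (n (Suc k) div n k)"
  using n_dvd_Suc by simp

lemma ratio_pos: "n (Suc k) div n k > 0"
  using n_dvd_Suc[of k] n_pos[of "Suc k"] n_pos[of k] by (simp add: dvd_imp_le div_greater_zero_iff)

lemma residue_less: "b < n k \<Longrightarrow> residue k b < n k"
proof (induction k arbitrary: b)
  case (Suc k)
  define m where "m = n (Suc k) div n k"
  have m: "m > 0" "n (Suc k) = n k * m" using ratio_pos n_Suc_eq by (auto simp: m_def)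
  have "b div m < n k" using Suc.prems m by (simp add: less_mult_imp_div_less)
  then have "residue k (b div m) < n k" by (rule Suc.IH)
  moreover have "n k * (b mod m) \<le> n k * (m - 1)"
    using mod_less_divisor[OF m(1), of b] by (intro mult_le_mono2) linarith
  moreover have "n k * (m - 1) + n k = n k * m" using m(1) by (cases m) auto
  ultimately have "residue k (b div m) + n k * (b mod m) < n k * m" by linarith
  then show ?case unfolding m(2)[symmetric] by (simp add: m_def)
qed simp

lemma inj_on_residue: "inj_on (residue k) {..<n k}"
proof (induction k)
  case (Suc k)
  define m where "m = n (Suc k) div n k"
  have m: "m > 0" "n (Suc k) = n k * m" using ratio_pos n_Suc_eq by (auto simp: m_def)
  show ?case
  proof (rule inj_onI)
    fix a b assume ab: "a \<in> {..<n (Suc k)}" "b \<in> {..<n (Suc k)}" "residue (Suc k) a = residue (Suc k) b"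
    have less: "a div m < n k" "b div m < n k" using ab m by (auto simp: less_mult_imp_div_less)
    then have res: "residue k (a div m) < n k" "residue k (b div m) < n k" by (auto intro: residue_less)
    have eq: "residue k (a div m) + n k * (a mod m) = residue k (b div m) + n k * (b mod m)"
      using ab(3) by (simp add: m_def)
    have "residue k (a div m) = residue k (b div m)"
      using arg_cong[OF eq, of "\<lambda>x. x mod n k"] res by simp
    moreover have "a mod m = b mod m"
      using arg_cong[OF eq, of "\<lambda>x. x div n k"] res by simp
    ultimately show "a = b"
      using inj_onD[OF Suc] less by (metis div_mult_mod_eq lessThan_iff)
  qed
qed simp

lemma bij_betw_residue: "bij_betw (residue k) {..<n k} {..<n k}"
  using inj_on_residue residue_less by (intro bij_betw_imageI endo_inj_surj) auto

text \<open>With \<open>m\<close> the ratio of the two periods, dividing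
  \<open>\<lfloor>n (Suc k) * u\<rfloor>\<close> by \<open>m\<close> gives
  \<open>\<lfloor>n k * u\<rfloor>\<close>: the next level appends one digit, and
  \<open>residue\<close> weights that digit by \<open>n k\<close>.\<close>

lemma digit_time_Suc_mod:
  "digit_time (Suc k) u mod n k = digit_time k u mod n k"
proof -
  define m where "m = n (Suc k) div n k"
  have m: "m > 0" "n (Suc k) = n k * m" using ratio_pos n_Suc_eq by (auto simp: m_def)
  have "\<lfloor>real (n k) * u\<rfloor> = \<lfloor>real (n (Suc k)) * u / real_of_int (int m)\<rfloor>" using m by simp
  also have "\<dots> = \<lfloor>real (n (Suc k)) * u\<rfloor> div int m" by (rule floor_divide_real_eq_div) simp
  finally have "nat \<lfloor>real (n (Suc k)) * u\<rfloor> div m = nat \<lfloor>real (n k) * u\<rfloor>" by (simp add: nat_div_distrib')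
  then show ?thesis by (simp add: digit_time_def m_def)
qed

lemma digit_time_mod: "k \<le> l \<Longrightarrow> digit_time l u mod n k = digit_time k u mod n k"
proof (induction l rule: dec_induct)
  case (step l)
  have "digit_time (Suc l) u mod n l mod n k = digit_time l u mod n l mod n k"
    by (simp add: digit_time_Suc_mod)
  then show ?case using step n_dvd[OF step(1)] by (simp add: mod_mod_cancel)
qed simp

text \<open>From level \<open>k\<close> on the times agree modulo \<open>n k\<close>, so
  \<open>near\<close> confines the tail to distance \<open>\<eta> k\<close> from its first term. The
  sequence is Cauchy, and the limit in \<open>coding\<close> exists.\<close>

lemma coding_in_X: "coding u \<in> X"
  and dist_coding: "dist (coding u) ((T ^^ digit_time k u) z) \<le> \<eta> k"
proof -
  have close: "dist ((T ^^ digit_time l u) z) ((T ^^ digit_time k u) z) \<le> \<eta> k" if "k \<le> l" for k l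
    using that by (intro near digit_time_mod)
  have "Cauchy (\<lambda>k. (T ^^ digit_time k u) z)"
  proof (rule metric_CauchyI)
    fix e :: real assume "e > 0"
    then obtain k where k: "\<eta> k < e / 2" using \<eta>_small[of "e / 2" 0] by auto
    have "dist ((T ^^ digit_time i u) z) ((T ^^ digit_time j u) z) < e" if "i \<ge> k" "j \<ge> k" for i j
      using close[OF that(1)] close[OF that(2)] k
        dist_triangle2[of "(T ^^ digit_time i u) z" "(T ^^ digit_time j u) z" "(T ^^ digit_time k u) z"]
      by linarith
    then show "\<exists>M. \<forall>i\<ge>M. \<forall>j\<ge>M. dist ((T ^^ digit_time i u) z) ((T ^^ digit_time j u) z) < e" by blast
  qed
  then obtain y where y: "y \<in> X" "(\<lambda>k. (T ^^ digit_time k u) z) \<longlonglongrightarrow> y"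
    using compact_imp_complete[OF compact_X] orbit_in_X by (metis completeE)
  then have "coding u = y" unfolding coding_def by (intro limI)
  then show "coding u \<in> X" "dist (coding u) ((T ^^ digit_time k u) z) \<le> \<eta> k"
    using y(1) LIMSEQ_le_const2[OF tendsto_dist[OF y(2) tendsto_const]] close by blast+
qed

lemma tendsto_coding: "(\<lambda>k. (T ^^ digit_time k u) z) \<longlonglongrightarrow> coding u"
proof (rule metric_LIMSEQ_I)
  fix e :: real assume "e > 0"
  then have "\<forall>\<^sub>F k in sequentially. \<eta> k < e" by (rule order_tendstoD(2)[OF \<eta>_lim])
  then obtain K where "\<And>k. k \<ge> K \<Longrightarrow> \<eta> k < e" by (auto simp: eventually_sequentially)
  then show "\<exists>K. \<forall>k\<ge>K. dist ((T ^^ digit_time k u) z) (coding u) < e"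
    using dist_coding by (metis dist_commute le_less_trans)
qed

lemma coding_in_orbit_closure: "coding u \<in> orbit_closure"
  unfolding orbit_closure_def closure_sequential
  using tendsto_coding by (intro exI[of _ "\<lambda>k. (T ^^ digit_time k u) z"]) auto

lemma prob_space_unit_interval: "prob_space unit_interval"
  by (rule prob_spaceI) (simp add: space_restrict_space emeasure_restrict_space)

lemma measurable_digit_time [measurable]: "digit_time k \<in> measurable unit_interval (count_space UNIV)"
proof -
  have "(\<lambda>u. \<lfloor>real (n k) * u\<rfloor>) \<in> measurable borel (count_space UNIV)"
    by measurable
  then have "(\<lambda>u. residue k (nat \<lfloor>real (n k) * u\<rfloor>)) \<in> measurable borel (count_space UNIV)"
    by (rule measurable_compose) simp
  then show ?thesis
    unfolding digit_time_def by (intro measurable_restrict_space1) (simp add: measurable_lborel1)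
qed

lemma measurable_coding: "coding \<in> measurable unit_interval (restrict_space borel X)"
proof (rule measurable_restrict_space2)
  show "coding \<in> borel_measurable unit_interval"
  proof (rule borel_measurable_LIMSEQ_metric[OF _ tendsto_coding])
    fix k
    show "(\<lambda>u. (T ^^ digit_time k u) z) \<in> borel_measurable unit_interval"
      by (rule measurable_compose[OF measurable_digit_time]) simp
  qed
qed (use coding_in_X in auto)

lemma odometer_measure_borel_prob: "odometer_measure \<in> borel_prob_measures X"
  using prob_space.prob_space_distr[OF prob_space_unit_interval measurable_coding]
  by (simp add: borel_prob_measures_def odometer_measure_def)

section \<open>Integrals against the odometer measure\<close>

lemma integral_odometer_measure:
  fixes f :: "'a \<Rightarrow> real"
  assumes "continuous_on X f"
  shows "(\<integral>x. f x \<partial>odometer_measure) = (\<integral>u. f (coding u) \<partial>unit_interval)"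
  unfolding odometer_measure_def
  using borel_measurable_continuous_on_restrict[OF assms]
  by (intro integral_distr measurable_coding)

text \<open>\<open>nat \<lfloor>p * u\<rfloor>\<close> takes each value below \<open>p\<close> on an
  interval of length \<open>1 / p\<close>.\<close>

lemma integral_step_function:
  fixes h :: "nat \<Rightarrow> real"
  assumes "p > 0"
  shows "(\<integral>u. h (nat \<lfloor>real p * u\<rfloor>) \<partial>unit_interval) = (\<Sum>b<p. h b) / p"
proof -
  define I where "I b = {real b / p..<(real b + 1) / p}" for b
  \<comment> \<open>\<open>0 \<le> u\<close> has to be stated: \<open>nat\<close> sends the negative
    floors to 0 as well.\<close>
  have floor: "u \<in> I b \<longleftrightarrow> 0 \<le> u \<and> nat \<lfloor>real p * u\<rfloor> = b" for u b
  proof -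
    have "u \<in> I b \<longleftrightarrow> real b \<le> real p * u \<and> real p * u < real b + 1"
      using assms by (simp add: I_def divide_le_eq less_divide_eq mult.commute)
    also have "\<dots> \<longleftrightarrow> \<lfloor>real p * u\<rfloor> = int b" by (auto simp: floor_eq_iff)
    also have "\<dots> \<longleftrightarrow> 0 \<le> u \<and> nat \<lfloor>real p * u\<rfloor> = b"
    proof -
      have "0 \<le> u" if "\<lfloor>real p * u\<rfloor> = int b"
      proof -
        have "0 \<le> real p * u" using that by (metis of_nat_0_le_iff zero_le_floor)
        then show ?thesis using assms by (simp add: zero_le_mult_iff)
      qed
      moreover have "0 \<le> \<lfloor>real p * u\<rfloor>" if "0 \<le> u" using that by simp
      ultimately show ?thesis by auto
    qed
    finally show ?thesis .
  qed
  have "indicator {0..<1} u *\<^sub>R h (nat \<lfloor>real p * u\<rfloor>) = (\<Sum>b<p. h b * indicator (I b) u)" for u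
  proof (cases "0 \<le> u \<and> u < 1")
    case True
    then have "real p * u < p" using assms by simp
    then have "nat \<lfloor>real p * u\<rfloor> < p" using True assms by (simp add: floor_less_iff nat_less_iff)
    moreover have "(\<Sum>b<p. h b * indicator (I b) u) = (\<Sum>b<p. if b = nat \<lfloor>real p * u\<rfloor> then h b else 0)"
      using True by (intro sum.cong) (auto simp: floor indicator_def)
    ultimately show ?thesis using True by simp
  next
    case False
    have "u \<notin> I b" if "b < p" for b
    proof
      assume u: "u \<in> I b"
      then have "(real b + 1) / p \<le> 1" using that assms by (simp add: divide_le_eq)
      then have "u < 1" using u by (simp add: I_def)
      moreover have "0 \<le> u" using u floor by blast
      ultimately show False using False by blast
    qed
    then show ?thesis using False by (auto simp: indicator_def)
  qed
  then have "(\<integral>u. h (nat \<lfloor>real p * u\<rfloor>) \<partial>unit_interval) = (\<integral>u. (\<Sum>b<p. h b * indicator (I b) u) \<partial>lborel)"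
    by (subst integral_restrict_space) auto
  also have "\<dots> = (\<Sum>b<p. h b * measure lborel (I b))"
  proof (subst Bochner_Integration.integral_sum)
    show "integrable lborel (\<lambda>u. h b * indicator (I b) u)" for b
      by (intro integrable_mult_right integrable_real_indicator) (use assms in \<open>auto simp: I_def divide_right_mono\<close>)
  qed (simp add: I_def)
  also have "measure lborel (I b) = 1 / p" for b
    using assms by (simp add: I_def divide_right_mono add_divide_distrib)
  then have "(\<Sum>b<p. h b * measure lborel (I b)) = (\<Sum>b<p. h b) / p"
    by (simp add: sum_divide_distrib)
  finally show ?thesis .
qed

text \<open>\<open>residue k\<close> permutes the indices below \<open>n k\<close>, so
  \<open>digit_time k\<close> is uniformly distributed on them.\<close>

lemma integral_digit_time:
  fixes h :: "nat \<Rightarrow> real"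
  shows "(\<integral>u. h (digit_time k u) \<partial>unit_interval) = (\<Sum>r<n k. h r) / n k"
proof -
  have "(\<integral>u. h (digit_time k u) \<partial>unit_interval) = (\<Sum>b<n k. h (residue k b)) / n k"
    unfolding digit_time_def by (rule integral_step_function[OF n_pos])
  also have "(\<Sum>b<n k. h (residue k b)) = (\<Sum>r<n k. h r)"
    by (rule sum.reindex_bij_betw[OF bij_betw_residue])
  finally show ?thesis .
qed

text \<open>It bounds the oscillation of \<open>f\<close> on every cylinder of level
  \<open>k\<close> by \<omega>. The distance bound is not strict because \<open>near\<close> and
  \<open>dist_cyl\<close> are not.\<close>

definition modulus :: "('a \<Rightarrow> real) \<Rightarrow> nat \<Rightarrow> real \<Rightarrow> bool" where
  "modulus f k \<omega> \<longleftrightarrow> (\<forall>x\<in>X. \<forall>y\<in>X. dist x y \<le> \<eta> k \<longrightarrow> \<bar>f x - f y\<bar> \<le> \<omega>)"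

lemma eventually_modulus:
  fixes f :: "'a \<Rightarrow> real"
  assumes "continuous_on X f" "\<omega> > 0"
  shows "\<forall>\<^sub>F k in sequentially. modulus f k \<omega>"
proof -
  have "uniformly_continuous_on X f" by (rule compact_uniformly_continuous[OF assms(1) compact_X])
  then obtain d where d: "d > 0" "\<And>x y. x \<in> X \<Longrightarrow> y \<in> X \<Longrightarrow> dist y x < d \<Longrightarrow> dist (f y) (f x) < \<omega>"
    using assms(2) unfolding uniformly_continuous_on_def by metis
  have "\<forall>\<^sub>F k in sequentially. \<eta> k < d" by (rule order_tendstoD(2)[OF \<eta>_lim d(1)])
  then show ?thesis
  proof eventually_elim
    case (elim k)
    then show ?case using d(2) by (fastforce simp: modulus_def dist_real_def)
  qed
qed

text \<open>Replacing \<open>coding u\<close> by its approximation of level \<open>k\<close> moves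
  the point by at most \<open>\<eta> k\<close>; the integral then becomes exactly the average over
  one period of the orbit of \<open>z\<close>.\<close>

lemma integral_near_orbit_average:
  fixes f :: "'a \<Rightarrow> real"
  assumes f: "continuous_on X f" and "modulus f k \<omega>"
  shows "\<bar>(\<integral>x. f x \<partial>odometer_measure) - birkhoff_avg T (n k) f z\<bar> \<le> \<omega>"
proof -
  interpret prob_space unit_interval by (rule prob_space_unit_interval)
  obtain B where B: "\<And>x. x \<in> X \<Longrightarrow> \<bar>f x\<bar> \<le> B"
    using continuous_on_compact_bound[OF compact_X f] by blast
  have int1: "integrable unit_interval (\<lambda>u. f (coding u))"
    using B coding_in_X measurable_compose[OF measurable_coding borel_measurable_continuous_on_restrict[OF f]]
    by (intro integrable_const_bound[of _ B]) auto
  have int2: "integrable unit_interval (\<lambda>u. f ((T ^^ digit_time k u) z))"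
    using B orbit_in_X measurable_compose[OF measurable_digit_time, of "\<lambda>i. f ((T ^^ i) z)" borel]
    by (intro integrable_const_bound[of _ B]) auto
  have "(\<integral>x. f x \<partial>odometer_measure) - birkhoff_avg T (n k) f z
      = (\<integral>u. f (coding u) - f ((T ^^ digit_time k u) z) \<partial>unit_interval)"
    using int1 int2 integral_digit_time[of "\<lambda>i. f ((T ^^ i) z)" k]
    by (simp add: integral_odometer_measure[OF f] birkhoff_avg_def)
  also have "\<bar>\<dots>\<bar> \<le> (\<integral>u. \<bar>f (coding u) - f ((T ^^ digit_time k u) z)\<bar> \<partial>unit_interval)"
    by (rule integral_abs_bound)
  also have "\<dots> \<le> (\<integral>u. \<omega> \<partial>unit_interval)"
  proof (rule integral_mono)
    show "integrable unit_interval (\<lambda>u. \<bar>f (coding u) - f ((T ^^ digit_time k u) z)\<bar>)"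
      by (intro integrable_abs Bochner_Integration.integrable_diff int1 int2)
    show "\<bar>f (coding u) - f ((T ^^ digit_time k u) z)\<bar> \<le> \<omega>" for u
      using assms(2) coding_in_X orbit_in_X dist_coding unfolding modulus_def by blast
  qed simp
  finally show ?thesis using prob_space by simp
qed

text \<open>Over a period the averages of \<open>f\<close> and of its composition with
  \<open>T\<close> differ by a telescoping sum, whose two boundary values are close because
  \<open>n k\<close> and 0 have the same residue.\<close>

lemma integral_odometer_measure_comp:
  fixes f :: "'a \<Rightarrow> real"
  assumes f: "continuous_on X f"
  shows "(\<integral>x. f (T x) \<partial>odometer_measure) = (\<integral>x. f x \<partial>odometer_measure)"
proof -
  have fT: "continuous_on X (\<lambda>x. f (T x))"
    by (rule continuous_on_compose2[OF f cont_T T_X])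
  have "\<bar>(\<integral>x. f (T x) \<partial>odometer_measure) - (\<integral>x. f x \<partial>odometer_measure)\<bar> \<le> e" if "e > 0" for e
  proof -
    have "e / 3 > 0" using that by simp
    have "\<forall>\<^sub>F k in sequentially. modulus f k (e / 3) \<and> modulus (\<lambda>x. f (T x)) k (e / 3)"
      by (intro eventually_conj eventually_modulus f fT \<open>e / 3 > 0\<close>)
    then obtain k where k: "modulus f k (e / 3)" "modulus (\<lambda>x. f (T x)) k (e / 3)"
      by (auto simp: eventually_sequentially)
    have "birkhoff_avg T (n k) (\<lambda>x. f (T x)) z - birkhoff_avg T (n k) f z
        = (f ((T ^^ n k) z) - f ((T ^^ 0) z)) / n k"
      using sum_lessThan_telescope[of "\<lambda>i. f ((T ^^ i) z)" "n k"]
      by (simp add: birkhoff_avg_def sum_subtractf flip: diff_divide_distrib)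
    also have "\<bar>\<dots>\<bar> \<le> e / 3"
    proof -
      have "dist ((T ^^ n k) z) ((T ^^ 0) z) \<le> \<eta> k" by (rule near) simp
      then have "\<bar>f ((T ^^ n k) z) - f ((T ^^ 0) z)\<bar> \<le> e / 3"
        using k(1) orbit_in_X unfolding modulus_def by blast
      also have "\<dots> \<le> e / 3 * n k"
        using \<open>e / 3 > 0\<close> n_pos[of k] by (simp add: mult_le_cancel_left1)
      finally show ?thesis using n_pos[of k] by (simp add: abs_divide divide_le_eq)
    qed
    finally show ?thesis
      using integral_near_orbit_average[OF f k(1)] integral_near_orbit_average[OF fT k(2)] by linarith
  qed
  then have "\<bar>(\<integral>x. f (T x) \<partial>odometer_measure) - (\<integral>x. f x \<partial>odometer_measure)\<bar> \<le> 0"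
    by (rule field_le_epsilon[of _ 0, simplified])
  then show ?thesis by simp
qed

lemma odometer_measure_invariant: "odometer_measure \<in> invariant_measures X T"
proof -
  let ?\<nu> = odometer_measure
  note \<nu> = odometer_measure_borel_prob
  interpret prob_space ?\<nu> using \<nu> by (simp add: borel_prob_measures_def)
  have T: "T \<in> measurable ?\<nu> ?\<nu>" by (rule measurable_self_map[OF \<nu> cont_T T_X])
  have \<nu>T: "distr ?\<nu> ?\<nu> T \<in> borel_prob_measures X"
    using prob_space_distr[OF T] \<nu> by (simp add: borel_prob_measures_def)
  have "measure ?\<nu> (T -` A \<inter> X) = measure ?\<nu> A" if A: "A \<in> sets ?\<nu>" for A
  proof -
    have "measure (distr ?\<nu> ?\<nu> T) A = measure ?\<nu> A"
    proof (rule borel_prob_measures_eqI[OF \<nu>T \<nu> compact_X])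
      fix f :: "'a \<Rightarrow> real" assume f: "continuous_on X f"
      show "(\<integral>x. f x \<partial>distr ?\<nu> ?\<nu> T) = (\<integral>x. f x \<partial>?\<nu>)"
        using integral_distr[OF T borel_measurable_continuous_on_carrier[OF \<nu> f]]
          integral_odometer_measure_comp[OF f] by simp
    qed (use A in simp)
    then show ?thesis using measure_distr[OF T A] by (simp add: space_borel_prob_measures[OF \<nu>])
  qed
  then show ?thesis using \<nu> by (simp add: invariant_measures_def)
qed

lemma measure_odometer_orbit_closure: "measure odometer_measure orbit_closure = 1"
proof -
  have "orbit_closure = orbit_closure \<inter> X" using orbit_closure_subset_X by blast
  moreover have "orbit_closure \<in> sets borel"
    by (simp add: orbit_closure_def)
  ultimately have "orbit_closure \<in> sets (restrict_space borel X)"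
    by (metis Int_commute sets_restrict_space image_eqI)
  then have "measure odometer_measure orbit_closure
      = measure unit_interval (coding -` orbit_closure \<inter> space unit_interval)"
    unfolding odometer_measure_def by (intro measure_distr measurable_coding)
  also have "coding -` orbit_closure \<inter> space unit_interval = space unit_interval"
    using coding_in_orbit_closure by blast
  finally show ?thesis using prob_space.prob_space[OF prob_space_unit_interval] by simp
qed

lemma odometer_measure_supported: "supported_on_odometer X T odometer_measure"
  unfolding supported_on_odometer_def
proof (intro exI conjI)
  show "closedin (top_of_set X) orbit_closure"
    using orbit_closure_subset_X by (intro closed_subset) (auto simp: orbit_closure_def)
qed (use T_orbit_closure measure_odometer_orbit_closure odometer_orbit_closure in auto)

text \<open>If \<open>x\<close> lies in \<open>cyl k r\<close>, its \<open>i\<close>-th iterate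
  shares a cylinder with the iterate of \<open>z\<close> at time \<open>(r + i) mod n k\<close>.
  Over one period these times run through every residue once, so the average along \<open>z\<close>
  is merely rearranged.\<close>

lemma birkhoff_avg_near_on_orbit_closure:
  assumes "modulus f k \<omega>" "x \<in> orbit_closure"
  shows "\<bar>birkhoff_avg T (n k) f x - birkhoff_avg T (n k) f z\<bar> \<le> \<omega>"
proof -
  obtain r where r: "x \<in> cyl k r" using orbit_closure_cyl[OF assms(2)] by blast
  have shift: "(\<Sum>i<n k. h ((r + i) mod n k)) = (\<Sum>i<n k. h i)" for h :: "nat \<Rightarrow> real"
  proof -
    have "inj_on (\<lambda>i. (r + i) mod n k) {..<n k}"
    proof (rule inj_onI)
      fix i j assume "i \<in> {..<n k}" "j \<in> {..<n k}" "(r + i) mod n k = (r + j) mod n k"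
      then show "i = j"
      proof (induction i j rule: linorder_wlog)
        case (le i j)
        then have "n k dvd (r + j) - (r + i)" by (metis mod_eq_dvd_iff_nat add_le_cancel_left)
        then have "n k dvd j - i" by simp
        then show ?case using le by (auto dest: dvd_imp_le)
      qed auto
    qed
    moreover have "(\<lambda>i. (r + i) mod n k) ` {..<n k} \<subseteq> {..<n k}" using n_pos[of k] by auto
    ultimately have "bij_betw (\<lambda>i. (r + i) mod n k) {..<n k} {..<n k}"
      by (intro bij_betw_imageI endo_inj_surj) auto
    then show ?thesis by (rule sum.reindex_bij_betw)
  qed
  have term_near: "\<bar>f ((T ^^ i) x) - f ((T ^^ ((r + i) mod n k)) z)\<bar> \<le> \<omega>" for i
  proof -
    have "(T ^^ i) x \<in> cyl k (r + i)" by (rule funpow_cyl[OF r])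
    moreover have "(T ^^ ((r + i) mod n k)) z \<in> cyl k (r + i)"
      using orbit_in_cyl[of "(r + i) mod n k" k] cyl_cong[of "(r + i) mod n k" k "r + i"] by simp
    ultimately have "dist ((T ^^ i) x) ((T ^^ ((r + i) mod n k)) z) \<le> \<eta> k" by (rule dist_cyl)
    moreover have "(T ^^ i) x \<in> X"
      using assms(2) orbit_closure_subset_X funpow_in_invariant_set[OF T_X] by blast
    ultimately show ?thesis using assms(1) orbit_in_X unfolding modulus_def by blast
  qed
  have "birkhoff_avg T (n k) f x - birkhoff_avg T (n k) f z
      = (\<Sum>i<n k. f ((T ^^ i) x) - f ((T ^^ ((r + i) mod n k)) z)) / n k"
    using shift[of "\<lambda>i. f ((T ^^ i) z)"] by (simp add: birkhoff_avg_def sum_subtractf diff_divide_distrib)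
  also have "\<bar>\<dots>\<bar> \<le> (\<Sum>i<n k. \<omega>) / n k"
    unfolding abs_divide abs_of_nat
    by (intro divide_right_mono order_trans[OF sum_abs] sum_mono term_near) simp
  also have "\<dots> = \<omega>" using n_pos[of k] by simp
  finally show ?thesis .
qed

lemma odometer_measure_variance:
  fixes f :: "'a \<Rightarrow> real"
  assumes f: "continuous_on X f" and "e > 0"
  shows "\<exists>N>0. (\<integral>x. (birkhoff_avg T N f x)\<^sup>2 \<partial>odometer_measure) - (\<integral>x. f x \<partial>odometer_measure)\<^sup>2 < e"
proof -
  let ?\<nu> = odometer_measure
  note \<nu> = odometer_measure_borel_prob
  interpret prob_space ?\<nu> using \<nu> by (simp add: borel_prob_measures_def)
  \<comment> \<open>On the orbit closure \<open>g\<close> is within \<open>2 * \<omega>\<close> of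
    \<open>c\<close>; as \<open>\<omega> \<le> 1\<close>, the square is at most
    \<open>4 * \<omega>\<close>, hence at most \<open>e / 2\<close>.\<close>
  define \<omega> where "\<omega> = min 1 (e / 8)"
  have \<omega>: "\<omega> > 0" "\<omega> \<le> 1" "8 * \<omega> \<le> e" using \<open>e > 0\<close> by (auto simp: \<omega>_def)
  obtain k where k: "modulus f k \<omega>"
    using eventually_modulus[OF f \<omega>(1)] by (auto simp: eventually_sequentially)
  define g where "g = birkhoff_avg T (n k) f"
  define c where "c = (\<integral>x. f x \<partial>?\<nu>)"
  have g_cont: "continuous_on X g"
    unfolding g_def by (rule continuous_on_birkhoff_avg[OF cont_T T_X f])
  have g_int: "integrable ?\<nu> g" by (rule integrable_continuous_on_carrier[OF \<nu> compact_X g_cont])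
  have g2_int: "integrable ?\<nu> (\<lambda>x. (g x)\<^sup>2)"
    by (intro integrable_continuous_on_carrier[OF \<nu> compact_X] continuous_on_power g_cont)
  have gc_int: "integrable ?\<nu> (\<lambda>x. (g x - c)\<^sup>2)"
    by (intro integrable_continuous_on_carrier[OF \<nu> compact_X] continuous_intros g_cont)
  have f_iter_int: "integrable ?\<nu> (\<lambda>x. f ((T ^^ i) x))" for i
    by (rule integrable_continuous_on_carrier[OF \<nu> compact_X],
        rule continuous_on_compose2[OF f continuous_on_funpow[OF cont_T T_X]])
       (use funpow_in_invariant_set[OF T_X] in auto)
  have g_mean: "(\<integral>x. g x \<partial>?\<nu>) = c"
    using n_pos[of k] f_iter_int borel_measurable_continuous_on_carrier[OF \<nu> f]
    by (simp add: g_def birkhoff_avg_def c_def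
        integral_invariant_funpow[OF odometer_measure_invariant cont_T T_X])
  have "(\<integral>x. (g x)\<^sup>2 \<partial>?\<nu>) - c\<^sup>2 = (\<integral>x. (g x - c)\<^sup>2 \<partial>?\<nu>)"
  proof -
    have "(\<integral>x. (g x - c)\<^sup>2 \<partial>?\<nu>) = (\<integral>x. (g x)\<^sup>2 + (c\<^sup>2 - 2 * c * g x) \<partial>?\<nu>)"
      by (simp add: power2_diff algebra_simps)
    also have "\<dots> = (\<integral>x. (g x)\<^sup>2 \<partial>?\<nu>) + (c\<^sup>2 - 2 * c * c)"
      using g2_int g_int by (simp add: g_mean prob_space)
    finally show ?thesis by (simp add: power2_eq_square)
  qed
  also have "\<dots> \<le> (\<integral>x. 4 * \<omega> \<partial>?\<nu>)"
  proof (rule integral_mono_AE)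
    \<comment> \<open>A nonmeasurable set has \<open>measure\<close> 0 by convention, so measure 1
      implies measurability.\<close>
    have "orbit_closure \<in> sets ?\<nu>"
      using measure_odometer_orbit_closure measure_notin_sets[of orbit_closure ?\<nu>] by force
    then have "AE x in ?\<nu>. x \<in> orbit_closure"
      using measure_odometer_orbit_closure by (simp add: prob_eq_1)
    then show "AE x in ?\<nu>. (g x - c)\<^sup>2 \<le> 4 * \<omega>"
    proof eventually_elim
      case (elim x)
      have "\<bar>g x - c\<bar> \<le> 2 * \<omega>"
        using birkhoff_avg_near_on_orbit_closure[OF k elim] integral_near_orbit_average[OF f k]
        unfolding g_def c_def by linarith
      then have "\<bar>g x - c\<bar> * \<bar>g x - c\<bar> \<le> (2 * \<omega>) * 2"
        using \<omega> by (intro mult_mono) auto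
      then show ?case by (simp add: power2_eq_square)
    qed
  qed (use gc_int in auto)
  also have "\<dots> < e" using \<omega> \<open>e > 0\<close> by (simp add: prob_space)
  finally show ?thesis using n_pos[of k] unfolding g_def c_def by blast
qed

end

section \<open>Density and genericity\<close>

text \<open>The measure is delivered with small variances for all continuous \<open>f\<close>, the
  property that yields its ergodicity and also places it in the open sets of the category
  argument.\<close>

lemma odometer_measure_approximation:
  fixes X :: "'a::metric_space set" and T :: "'a \<Rightarrow> 'a" and F :: "('a \<Rightarrow> real) set"
  assumes sys: "dynamical_system X T" and trans: "transitive_system X T" and shadow: "shadowing X T"
    and \<mu>: "\<mu> \<in> invariant_measures X T"
    and F: "finite F" "\<And>f. f \<in> F \<Longrightarrow> continuous_on X f" and "e > 0"
  shows "\<exists>\<nu>\<in>invariant_measures X T. supported_on_odometer X T \<nu> \<and>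
    (\<forall>f e. continuous_on X f \<longrightarrow> e > 0 \<longrightarrow>
      (\<exists>N>0. (\<integral>x. (birkhoff_avg T N f x)\<^sup>2 \<partial>\<nu>) - (\<integral>x. f x \<partial>\<nu>)\<^sup>2 < e)) \<and>
    (\<forall>f\<in>F. \<bar>(\<integral>x. f x \<partial>\<nu>) - (\<integral>x. f x \<partial>\<mu>)\<bar> < e)"
proof -
  have X: "compact X" "continuous_on X T" "T ` X \<subseteq> X" using sys by (auto simp: dynamical_system_def)
  have "\<exists>d>0. \<forall>x\<in>X. \<forall>y\<in>X. dist x y < d \<longrightarrow> \<bar>f x - f y\<bar> < e / 4" if "f \<in> F" for f
  proof -
    have "uniformly_continuous_on X f" using compact_uniformly_continuous[OF F(2)[OF that] X(1)] .
    moreover have "e / 4 > 0" using \<open>e > 0\<close> by simp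
    ultimately obtain d where "d > 0" "\<And>x y. x \<in> X \<Longrightarrow> y \<in> X \<Longrightarrow> dist y x < d \<Longrightarrow> dist (f y) (f x) < e / 4"
      unfolding uniformly_continuous_on_def by meson
    then show ?thesis by (auto simp: dist_real_def)
  qed
  then obtain d where d: "\<And>f. f \<in> F \<Longrightarrow> d f > 0"
      "\<And>f x y. f \<in> F \<Longrightarrow> x \<in> X \<Longrightarrow> y \<in> X \<Longrightarrow> dist x y < d f \<Longrightarrow> \<bar>f x - f y\<bar> < e / 4"
    by metis
  \<comment> \<open>Half the minimum lies strictly below each \<open>d f\<close>, so that uniform
    continuity applies to distances up to and including \<open>r\<close>.\<close>
  define r where "r = Min (insert 1 (d ` F)) / 2"
  have "Min (insert 1 (d ` F)) > 0" using F(1) d(1) by auto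
  then have r: "r > 0" "\<And>f. f \<in> F \<Longrightarrow> r < d f"
  proof -
    assume pos: "Min (insert 1 (d ` F)) > 0"
    then show "r > 0" by (simp add: r_def)
    fix f assume "f \<in> F"
    then have "Min (insert 1 (d ` F)) \<le> d f" using F(1) by (intro Min_le) auto
    then show "r < d f" using pos by (simp add: r_def)
  qed
  have mod: "\<bar>f x - f y\<bar> \<le> e / 4" if "f \<in> F" "x \<in> X" "y \<in> X" "dist x y \<le> r" for f x y
    using d(2)[OF that(1-3)] r(2)[OF that(1)] that(4) by simp
  obtain \<delta> where \<delta>: "\<delta> > 0" "\<And>x p. p > 0 \<Longrightarrow> pseudo_orbit X T \<delta> x \<Longrightarrow> \<forall>i. x (i + p) = x i \<Longrightarrow>
    \<exists>z\<in>X. \<exists>n. n 0 = p \<and> (\<forall>k. n k > 0 \<and> n k dvd n (Suc k)) \<and>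
       (\<forall>k i j. i mod n k = j mod n k \<longrightarrow> dist ((T ^^ i) z) ((T ^^ j) z) \<le> r / 2 ^ k) \<and>
       (\<forall>i. dist ((T ^^ i) z) (x i) \<le> r)"
    using shadowing_limit_orbit[OF sys shadow r(1)] by blast
  have "e / 4 > 0" using \<open>e > 0\<close> by simp
  have "\<exists>x p. p > 0 \<and> pseudo_orbit X T \<delta> x \<and> (\<forall>i. x (i + p) = x i) \<and>
      (\<forall>f\<in>F. \<bar>(\<Sum>i<p. f (x i)) / p - (\<integral>x. f x \<partial>\<mu>)\<bar> < e / 4)"
    by (rule invariant_measure_approx_periodic_pseudo_orbit[OF sys trans \<mu> F \<open>e / 4 > 0\<close> \<delta>(1)])
  then obtain x p where x: "p > 0" "pseudo_orbit X T \<delta> x" "\<forall>i. x (i + p) = x i"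
      "\<And>f. f \<in> F \<Longrightarrow> \<bar>(\<Sum>i<p. f (x i)) / p - (\<integral>x. f x \<partial>\<mu>)\<bar> < e / 4"
    by blast
  obtain z n where zn: "z \<in> X" "n 0 = p" "\<And>k. n k > 0" "\<And>k. n k dvd n (Suc k)"
      "\<And>k i j. i mod n k = j mod n k \<Longrightarrow> dist ((T ^^ i) z) ((T ^^ j) z) \<le> r / 2 ^ k"
      "\<And>i. dist ((T ^^ i) z) (x i) \<le> r"
    using \<delta>(2)[OF x(1-3)] by blast
  have "(\<lambda>k. r / 2 ^ k) \<longlonglongrightarrow> 0" by real_asymp
  then interpret nested_almost_periods X T z n "\<lambda>k. r / 2 ^ k"
    using X zn by unfold_locales auto
  have "\<bar>(\<integral>x. f x \<partial>odometer_measure) - (\<integral>x. f x \<partial>\<mu>)\<bar> < e" if f: "f \<in> F" for f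
  proof -
    \<comment> \<open>Level 0 suffices: its period is \<open>p\<close> and its scale is
      \<open>r\<close>. Three errors follow, from the integral to the orbit of \<open>z\<close>,
      from there to the pseudo-orbit, and from there to \<mu>.\<close>
    have "modulus f 0 (e / 4)" using mod[OF f] by (simp add: modulus_def)
    then have "\<bar>(\<integral>x. f x \<partial>odometer_measure) - birkhoff_avg T p f z\<bar> \<le> e / 4"
      using integral_near_orbit_average[OF F(2)[OF f]] zn(2) by metis
    moreover have "\<bar>birkhoff_avg T p f z - (\<Sum>i<p. f (x i)) / p\<bar> \<le> e / 4"
    proof -
      have "birkhoff_avg T p f z - (\<Sum>i<p. f (x i)) / p = (\<Sum>i<p. f ((T ^^ i) z) - f (x i)) / p"
        by (simp add: birkhoff_avg_def sum_subtractf diff_divide_distrib)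
      also have "\<bar>\<dots>\<bar> \<le> (\<Sum>i<p. e / 4) / p"
        unfolding abs_divide abs_of_nat
      proof (intro divide_right_mono order_trans[OF sum_abs] sum_mono)
        show "\<bar>f ((T ^^ i) z) - f (x i)\<bar> \<le> e / 4" for i
          using x(2) by (intro mod[OF f] orbit_in_X zn(6)) (simp add: pseudo_orbit_def)
      qed simp
      also have "\<dots> = e / 4" using x(1) by simp
      finally show ?thesis .
    qed
    ultimately show ?thesis using x(4)[OF f] \<open>e > 0\<close> by linarith
  qed
  then show ?thesis
    using odometer_measure_invariant odometer_measure_supported odometer_measure_variance by blast
qed

lemma continuous_map_integral:
  fixes X :: "'a::metric_space set" and f :: "'a \<Rightarrow> real"
  assumes "continuous_on X f"
  shows "continuous_map (invariant_measures_topology X T) euclideanreal (\<lambda>\<mu>. \<integral>x. f x \<partial>\<mu>)"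
proof -
  let ?F = "{f :: 'a \<Rightarrow> real. continuous_on X f}"
  have "continuous_map (powertop_real ?F) euclideanreal (\<lambda>v. v f)"
    using assms by (intro continuous_map_product_projection) simp
  then have "continuous_map (weak_star_topology X) euclideanreal ((\<lambda>v. v f) \<circ> (\<lambda>\<mu>. \<lambda>f\<in>?F. \<integral>x. f x \<partial>\<mu>))"
    unfolding weak_star_topology_def by (rule continuous_map_pullback)
  moreover have "(\<lambda>v. v f) \<circ> (\<lambda>\<mu>. \<lambda>f\<in>?F. \<integral>x. f x \<partial>\<mu>) = (\<lambda>\<mu>. \<integral>x. f x \<partial>\<mu>)"
    using assms by (simp add: fun_eq_iff)
  ultimately show ?thesis
    unfolding invariant_measures_topology_def using continuous_map_from_subtopology by metis
qed

text \<open>A basic open set of the product topology restricts finitely many coordinates only. These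
  form \<open>F\<close>, and \<open>e\<close> is the smallest radius that fits into their open
  sets.\<close>

lemma openin_invariant_measures_topology_basic:
  fixes X :: "'a::metric_space set"
  assumes "openin (invariant_measures_topology X T) V" "\<mu> \<in> V"
  shows "\<exists>F e. finite F \<and> (\<forall>f\<in>F. continuous_on X f) \<and> e > 0 \<and>
    (\<forall>\<nu>\<in>invariant_measures X T. (\<forall>f\<in>F. \<bar>(\<integral>x. f x \<partial>\<nu>) - (\<integral>x. f x \<partial>\<mu>)\<bar> < (e::real)) \<longrightarrow> \<nu> \<in> V)"
proof -
  let ?F = "{f :: 'a \<Rightarrow> real. continuous_on X f}"
  define ev where "ev = (\<lambda>\<mu> :: 'a measure. \<lambda>f\<in>?F. \<integral>x. f x \<partial>\<mu>)"
  obtain O' where O': "openin (powertop_real ?F) O'"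
      "V = ev -` O' \<inter> borel_prob_measures X \<inter> invariant_measures X T"
    using assms(1) unfolding invariant_measures_topology_def weak_star_topology_def openin_subtopology
      openin_pullback_topology ev_def by blast
  then obtain U where U: "finite {f \<in> ?F. U f \<noteq> topspace euclideanreal}"
      "\<And>f. f \<in> ?F \<Longrightarrow> openin euclideanreal (U f)" "ev \<mu> \<in> Pi\<^sub>E ?F U" "Pi\<^sub>E ?F U \<subseteq> O'"
  proof -
    have "ev \<mu> \<in> O'" using assms(2) O'(2) by simp
    then show ?thesis using that O'(1)[unfolded openin_product_topology_alt] by meson
  qed
  define F where "F = {f \<in> ?F. U f \<noteq> UNIV}"
  have F: "finite F" using U(1) by (simp add: F_def)
  have "\<exists>e>0. \<forall>y. \<bar>y - (\<integral>x. f x \<partial>\<mu>)\<bar> < e \<longrightarrow> y \<in> U f" if "f \<in> F" for f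
  proof -
    have f: "f \<in> ?F" using that by (simp add: F_def)
    then have "(\<integral>x. f x \<partial>\<mu>) \<in> U f" using U(3) by (auto simp: ev_def PiE_iff)
    moreover have "open (U f)" using U(2)[OF f] by simp
    ultimately show ?thesis unfolding open_dist dist_real_def by blast
  qed
  then obtain \<epsilon> where \<epsilon>: "\<And>f. f \<in> F \<Longrightarrow> \<epsilon> f > 0"
      "\<And>f y. f \<in> F \<Longrightarrow> \<bar>y - (\<integral>x. f x \<partial>\<mu>)\<bar> < \<epsilon> f \<Longrightarrow> y \<in> U f" by metis
  define e where "e = Min (insert 1 (\<epsilon> ` F))"
  have e: "e > 0" "\<And>f. f \<in> F \<Longrightarrow> e \<le> \<epsilon> f" using F \<epsilon>(1) by (auto simp: e_def)
  have "\<nu> \<in> V" if \<nu>: "\<nu> \<in> invariant_measures X T"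
    "\<forall>f\<in>F. \<bar>(\<integral>x. f x \<partial>\<nu>) - (\<integral>x. f x \<partial>\<mu>)\<bar> < e" for \<nu>
  proof -
    have "(\<integral>x. f x \<partial>\<nu>) \<in> U f" if f: "f \<in> ?F" for f
    proof (cases "f \<in> F")
      case True
      then show ?thesis using \<nu>(2) e(2)[OF True] by (intro \<epsilon>(2)) auto
    next
      case False
      then show ?thesis using f by (simp add: F_def)
    qed
    then have "ev \<nu> \<in> Pi\<^sub>E ?F U" by (simp add: ev_def)
    then show ?thesis using U(4) \<nu>(1) unfolding O'(2) by (auto simp: invariant_measures_def)
  qed
  then show ?thesis using F e(1) by (intro exI[of _ F] exI[of _ e]) (auto simp: F_def)
qed

lemma compact_countable_dense:
  fixes X :: "'a::metric_space set"
  assumes "compact X"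
  obtains D where "countable D" "X \<subseteq> closure D"
proof -
  have "\<exists>P. finite P \<and> X \<subseteq> (\<Union>c\<in>P. ball c (inverse (Suc j)))" for j
    using seq_compact_imp_totally_bounded[OF compact_imp_seq_compact[OF assms], rule_format, of "inverse (Suc j)"]
    by auto
  then obtain P where P: "\<And>j. finite (P j)" "\<And>j. X \<subseteq> (\<Union>c\<in>P j. ball c (inverse (Suc j)))" by metis
  show ?thesis
  proof (rule that[of "\<Union>j. P j"])
    show "countable (\<Union>j. P j)" using P(1) by (simp add: countable_finite)
    show "X \<subseteq> closure (\<Union>j. P j)"
    proof
      fix x assume x: "x \<in> X"
      show "x \<in> closure (\<Union>j. P j)"
        unfolding closure_approachable
      proof (intro allI impI)
        fix e :: real assume "e > 0"
        then obtain j where "inverse (real (Suc j)) < e" using reals_Archimedean by blast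
        moreover obtain c where "c \<in> P j" "dist c x < inverse (real (Suc j))" using subsetD[OF P(2) x, of j] by auto
        ultimately show "\<exists>y\<in>\<Union>j. P j. dist y x < e" by (meson UN_I UNIV_I order_less_trans)
      qed
    qed
  qed
qed

section \<open>Baire category and the open conditions\<close>

lemma nowhere_dense_in_Diff_open_dense:
  assumes "openin Y U" "Y closure_of S = topspace Y" "S \<subseteq> U"
  shows "nowhere_dense_in Y (topspace Y - U)"
proof -
  have "Y closure_of (topspace Y - U) = topspace Y - U"
    using assms(1) by (simp add: closure_of_eq closedin_diff)
  moreover have "Y interior_of (topspace Y - U) = {}"
  proof (rule ccontr)
    assume "Y interior_of (topspace Y - U) \<noteq> {}"
    then obtain x where x: "x \<in> Y interior_of (topspace Y - U)" by blast
    then have "x \<in> Y closure_of S"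
      unfolding assms(2) using interior_of_subset_topspace[of Y "topspace Y - U"] by (rule subsetD[rotated])
    then obtain y where "y \<in> S" "y \<in> Y interior_of (topspace Y - U)"
      using x openin_interior_of unfolding in_closure_of by blast
    then show False using interior_of_subset[of Y "topspace Y - U"] assms(3) by blast
  qed
  ultimately show ?thesis by (simp add: nowhere_dense_in_def)
qed

lemma nowhere_dense_in_subset:
  assumes "nowhere_dense_in Y N" "M \<subseteq> N"
  shows "nowhere_dense_in Y M"
proof -
  have "Y interior_of (Y closure_of M) \<subseteq> Y interior_of (Y closure_of N)"
    by (intro interior_of_mono closure_of_mono assms(2))
  then show ?thesis using assms by (auto simp: nowhere_dense_in_def)
qed

lemma residual_in_if_contains_countable_Inter:
  assumes "countable J" "\<And>i. i \<in> J \<Longrightarrow> openin Y (U i)" "S \<subseteq> topspace Y"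
    and dense: "Y closure_of D = topspace Y" "\<And>i. i \<in> J \<Longrightarrow> D \<subseteq> U i"
    and sub: "\<And>x. x \<in> topspace Y \<Longrightarrow> (\<And>i. i \<in> J \<Longrightarrow> x \<in> U i) \<Longrightarrow> x \<in> S"
  shows "residual_in Y S"
proof -
  \<comment> \<open>\<open>first_category_in\<close> demands equality with the union, so each
    nowhere dense complement is cut down to the complement of \<open>S\<close>.\<close>
  define N where "N i = (topspace Y - S) \<inter> (topspace Y - U i)" for i
  have "nowhere_dense_in Y (N i)" if "i \<in> J" for i
    by (rule nowhere_dense_in_subset[OF nowhere_dense_in_Diff_open_dense[OF assms(2) dense(1)]])
       (use that dense(2) in \<open>auto simp: N_def\<close>)
  moreover have "topspace Y - S = \<Union>(N ` J)" using sub by (auto simp: N_def)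
  ultimately have "first_category_in Y (topspace Y - S)"
    unfolding first_category_in_def using assms(1) by (intro exI[of _ "N ` J"]) auto
  then show ?thesis using assms(3) by (simp add: residual_in_def)
qed

text \<open>For fixed \<open>N\<close> the expression is continuous in \<mu>, as both integrands are
  continuous on \<open>X\<close>; the set is the union over \<open>N\<close> of preimages of a
  half-line. On invariant measures the expression is the variance, because a Birkhoff average has
  the mean of \<open>f\<close>.\<close>

lemma openin_small_variance:
  fixes X :: "'a::metric_space set" and f :: "'a \<Rightarrow> real"
  assumes sys: "dynamical_system X T" and f: "continuous_on X f"
  shows "openin (invariant_measures_topology X T) {\<mu> \<in> invariant_measures X T.
    \<exists>N>0. (\<integral>x. (birkhoff_avg T N f x)\<^sup>2 \<partial>\<mu>) - (\<integral>x. f x \<partial>\<mu>)\<^sup>2 < e}"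
proof -
  let ?Y = "invariant_measures_topology X T"
  have X: "continuous_on X T" "T ` X \<subseteq> X" using sys by (auto simp: dynamical_system_def)
  have "openin ?Y {\<mu> \<in> topspace ?Y.
      (\<integral>x. (birkhoff_avg T N f x)\<^sup>2 \<partial>\<mu>) - (\<integral>x. f x \<partial>\<mu>)\<^sup>2 \<in> {..<e}}" for N
  proof (rule openin_continuous_map_preimage)
    show "continuous_map ?Y euclideanreal
        (\<lambda>\<mu>. (\<integral>x. (birkhoff_avg T N f x)\<^sup>2 \<partial>\<mu>) - (\<integral>x. f x \<partial>\<mu>)\<^sup>2)"
      by (intro continuous_map_diff continuous_map_real_pow continuous_map_integral f
          continuous_on_power continuous_on_birkhoff_avg X)
  qed simp
  then have "openin ?Y (\<Union>N\<in>{0<..}. {\<mu> \<in> topspace ?Y.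
      (\<integral>x. (birkhoff_avg T N f x)\<^sup>2 \<partial>\<mu>) - (\<integral>x. f x \<partial>\<mu>)\<^sup>2 \<in> {..<e}})"
    by blast
  also have "(\<Union>N\<in>{0<..}. {\<mu> \<in> topspace ?Y.
      (\<integral>x. (birkhoff_avg T N f x)\<^sup>2 \<partial>\<mu>) - (\<integral>x. f x \<partial>\<mu>)\<^sup>2 \<in> {..<e}}) =
      {\<mu> \<in> invariant_measures X T.
        \<exists>N>0. (\<integral>x. (birkhoff_avg T N f x)\<^sup>2 \<partial>\<mu>) - (\<integral>x. f x \<partial>\<mu>)\<^sup>2 < e}"
    by auto
  finally show ?thesis .
qed

theorem theoremA:
  fixes X :: "'a::metric_space set" and T :: "'a \<Rightarrow> 'a"
  assumes "dynamical_system X T"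
    and "transitive_system X T"
    and "shadowing X T"
  shows "dense_in (invariant_measures_topology X T)
           {\<mu> \<in> ergodic_measures X T. supported_on_odometer X T \<mu>}
       \<and> residual_in (invariant_measures_topology X T) (ergodic_measures X T)"
proof -
  let ?Y = "invariant_measures_topology X T"
  let ?small = "\<lambda>\<mu> f e. \<exists>N>0. (\<integral>x. (birkhoff_avg T N f x)\<^sup>2 \<partial>\<mu>) - (\<integral>x. f x \<partial>\<mu>)\<^sup>2 < e"
  have "compact X" using assms(1) by (simp add: dynamical_system_def)
  obtain D where D: "countable D" "X \<subseteq> closure D" using compact_countable_dense[OF \<open>compact X\<close>] by blast
  \<comment> \<open>One dense set serves both claims: it consists of ergodic measures supported on
    odometers, and it lies in every open set \<open>U i\<close> below.\<close>
  define O1 where "O1 = {\<mu> \<in> invariant_measures X T. supported_on_odometer X T \<mu> \<and>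
      (\<forall>f e. continuous_on X f \<longrightarrow> e > 0 \<longrightarrow> ?small \<mu> f e)}"
  have ergodic: "O1 \<subseteq> ergodic_measures X T"
    by (auto simp: O1_def intro!: ergodic_if_variances_small[OF assms(1) _ D(2)] continuous_on_bump)
  have dense: "?Y closure_of O1 = topspace ?Y"
  proof (rule antisym[OF closure_of_subset_topspace], rule subsetI)
    fix \<mu> assume \<mu>: "\<mu> \<in> topspace ?Y"
    have "\<exists>\<nu>\<in>O1. \<nu> \<in> V" if V: "\<mu> \<in> V" "openin ?Y V" for V
    proof -
      obtain F e where F: "finite F" "\<forall>f\<in>F. continuous_on X f" "(e::real) > 0"
          "\<forall>\<nu>\<in>invariant_measures X T. (\<forall>f\<in>F. \<bar>(\<integral>x. f x \<partial>\<nu>) - (\<integral>x. f x \<partial>\<mu>)\<bar> < e) \<longrightarrow> \<nu> \<in> V"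
        using openin_invariant_measures_topology_basic[OF V(2,1)] by blast
      then show ?thesis
        using odometer_measure_approximation[OF assms, of \<mu> F e] \<mu> unfolding O1_def by auto
    qed
    then show "\<mu> \<in> ?Y closure_of O1" using \<mu> by (auto simp: in_closure_of)
  qed
  have "topspace ?Y \<subseteq> ?Y closure_of {\<mu> \<in> ergodic_measures X T. supported_on_odometer X T \<mu>}"
    unfolding dense[symmetric] using ergodic by (intro closure_of_mono) (auto simp: O1_def)
  then have "dense_in ?Y {\<mu> \<in> ergodic_measures X T. supported_on_odometer X T \<mu>}"
    using closure_of_subset_topspace[of ?Y] by (auto simp: dense_in_def ergodic_measures_def)
  moreover have "residual_in ?Y (ergodic_measures X T)"
  proof (rule residual_in_if_contains_countable_Inter[OF _ _ _ dense])
    \<comment> \<open>Finite subsets of the countable set \<open>D\<close>, the slope of the bump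
      and the reciprocal bound \<open>inverse (Suc j)\<close> make the family of open conditions
      countable.\<close>
    define J :: "('a set \<times> nat \<times> nat) set" where "J = {S. finite S \<and> S \<subseteq> D} \<times> UNIV"
    define U where "U = (\<lambda>(S, m, j :: nat). {\<mu> \<in> invariant_measures X T. ?small \<mu> (bump S m) (inverse (Suc j))})"
    show "countable J"
      unfolding J_def using countable_Collect_finite_subset[OF D(1)] by (intro countable_SIGMA) auto
    show "openin ?Y (U i)" if "i \<in> J" for i
      unfolding U_def by (cases i) (auto intro!: openin_small_variance assms(1) continuous_on_bump)
    show "ergodic_measures X T \<subseteq> topspace ?Y" by (auto simp: ergodic_measures_def)
    show "O1 \<subseteq> U i" if "i \<in> J" for i
    proof (cases i)
      case (fields S m j)
      have "?small \<mu> (bump S m) (inverse (Suc j))" if "\<mu> \<in> O1" for \<mu>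
      proof -
        have "inverse (real (Suc j)) > 0" by simp
        then show ?thesis using that continuous_on_bump unfolding O1_def by blast
      qed
      then show ?thesis by (auto simp: fields U_def O1_def)
    qed
    show "\<mu> \<in> ergodic_measures X T" if \<mu>: "\<mu> \<in> topspace ?Y" "\<And>i. i \<in> J \<Longrightarrow> \<mu> \<in> U i" for \<mu>
    proof (rule ergodic_if_variances_small[OF assms(1) _ D(2)])
      show "\<mu> \<in> invariant_measures X T" using \<mu>(1) by simp
      fix S m and e :: real assume S: "finite S" "S \<subseteq> D" "e > 0"
      obtain j where j: "inverse (real (Suc j)) < e" using reals_Archimedean[OF S(3)] by blast
      have "?small \<mu> (bump S m) (inverse (Suc j))" using \<mu>(2)[of "(S, m, j)"] S by (auto simp: J_def U_def)
      then show "?small \<mu> (bump S m) e" using j by (meson order_less_trans)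
    qed
  qed
  ultimately show ?thesis by blast
qed

end
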